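(* Let $b$ be a symbol of the form $$b(t)=\sum_{j=-1}^\infty b_jt^j,\quad t\in\mathbb{T},\qquad b_j\in\mathbb{C},\qquad \sum_{j\ge0}(j+1)|b_j|<\infty.$$ Then there is a constant $C(b)>0$, depending only on $b$, such that $$\|(T_b-w)^{-1}\|\le \frac{C(b)}{\operatorname{dist}(w,\sigma(T_b))}\left(1+\frac1{\operatorname{dist}(w,\sigma(T_b))}\right)\qquad\text{for all } w\in\rho(T_b).$$
   Context: Notation: $\mathbb{T}=\{z\in\mathbb{C}:|z|=1\}$. The Toeplitz operator $T_b$ acts on the Hardy space $H^2(\mathbb{T})$ by $T_bf=P_+(bf)$, where $P_+$ is the orthogonal projection of $L^2(\mathbb{T})$ onto $H^2(\mathbb{T})$; equivalently, $T_b$ is the operator on $\ell^2(\mathbb{N})$ with matrix $(b_{i-j})_{i,j\ge1}$, where $b_n$ are the Fourier coefficients of $b$ (so $b_n=0$ for $n<-1$ here). Here $\sigma(T_b)$ is the spectrum, $\rho(T_b)=\mathbb{C}\setminus\sigma(T_b)$ the resolvent set, and $\|\cdot\|$ the operator norm. *)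

theory Defs
  imports "HOL-Analysis.Analysis"
begin

section \<open>The Hilbert space of square-summable complex sequences\<close>

typedef ell2 = "{x :: nat \<Rightarrow> complex. summable (\<lambda>i. (cmod (x i))\<^sup>2)}"
  morphisms ell2_nth Abs_ell2
  by (rule exI[of _ "\<lambda>_. 0"]) simp

setup_lifting type_definition_ell2

lemma square_sum_bound: "(cmod (a + b))\<^sup>2 \<le> 2 * (cmod a)\<^sup>2 + 2 * (cmod b)\<^sup>2"
proof -
  have "(cmod (a + b))\<^sup>2 \<le> (cmod a + cmod b)\<^sup>2"
    by (intro power_mono norm_triangle_ineq) auto
  also have "\<dots> \<le> 2 * (cmod a)\<^sup>2 + 2 * (cmod b)\<^sup>2"
    using sum_squares_bound[of "cmod a" "cmod b"] by (simp add: power2_sum)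
  finally show ?thesis .
qed

lemma square_summable_add:
  assumes "summable (\<lambda>i. (cmod (x i))\<^sup>2)" "summable (\<lambda>i. (cmod (y i))\<^sup>2)"
  shows "summable (\<lambda>i. (cmod (x i + y i))\<^sup>2)"
  by (rule summable_comparison_test'[where N = 0 and
        g = "\<lambda>i. 2 * (cmod (x i))\<^sup>2 + 2 * (cmod (y i))\<^sup>2"])
     (use assms square_sum_bound in \<open>auto intro!: summable_add summable_mult\<close>)

lemma square_summable_cmult:
  assumes "summable (\<lambda>i. (cmod (x i))\<^sup>2)"
  shows "summable (\<lambda>i. (cmod (c * x i))\<^sup>2)"
  using assms by (simp add: norm_mult power_mult_distrib summable_mult)

lift_definition ell2_cscale :: "complex \<Rightarrow> ell2 \<Rightarrow> ell2"  (infixr "*\<^sub>C" 75)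
  is "\<lambda>c x i. c * x i"
  by (rule square_summable_cmult)

lemma summable_cmod_square: "summable (\<lambda>i. (cmod (ell2_nth x i))\<^sup>2)"
  using ell2_nth[of x] by simp

text \<open>The real inner product is the real part of the usual Hermitian one, so that it induces
  the usual norm.\<close>

instantiation ell2 :: real_inner
begin

lift_definition zero_ell2 :: ell2 is "\<lambda>_. 0" by simp

lift_definition plus_ell2 :: "ell2 \<Rightarrow> ell2 \<Rightarrow> ell2" is "\<lambda>x y i. x i + y i"
  by (rule square_summable_add)

lift_definition uminus_ell2 :: "ell2 \<Rightarrow> ell2" is "\<lambda>x i. - x i" by simp

definition minus_ell2 :: "ell2 \<Rightarrow> ell2 \<Rightarrow> ell2" where "minus_ell2 x y = x + (- y)"

definition scaleR_ell2 :: "real \<Rightarrow> ell2 \<Rightarrow> ell2" where "scaleR_ell2 r x = of_real r *\<^sub>C x"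

definition inner_ell2 :: "ell2 \<Rightarrow> ell2 \<Rightarrow> real"
  where "inner_ell2 x y = (\<Sum>i. Re (ell2_nth x i * cnj (ell2_nth y i)))"

definition norm_ell2 :: "ell2 \<Rightarrow> real"
  where "norm_ell2 x = sqrt (\<Sum>i. (cmod (ell2_nth x i))\<^sup>2)"

definition dist_ell2 :: "ell2 \<Rightarrow> ell2 \<Rightarrow> real" where "dist_ell2 x y = norm (x - y)"

definition sgn_ell2 :: "ell2 \<Rightarrow> ell2" where "sgn_ell2 x = inverse (norm x) *\<^sub>R x"

definition uniformity_ell2 :: "(ell2 \<times> ell2) filter"
  where "uniformity_ell2 = (INF e\<in>{0<..}. principal {(x, y). dist x y < e})"

definition open_ell2 :: "ell2 set \<Rightarrow> bool"
  where "open_ell2 U = (\<forall>x\<in>U. \<forall>\<^sub>F (x', y) in uniformity. x' = x \<longrightarrow> y \<in> U)"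

instance
proof
  have summ: "summable (\<lambda>i. Re (ell2_nth x i * cnj (ell2_nth y i)))" for x y
  proof (rule summable_comparison_test'[where N = 0])
    show "summable (\<lambda>i. (cmod (ell2_nth x i))\<^sup>2 + (cmod (ell2_nth y i))\<^sup>2)"
      by (intro summable_add summable_cmod_square)
    fix i
    have "\<bar>Re (ell2_nth x i * cnj (ell2_nth y i))\<bar> \<le> cmod (ell2_nth x i) * cmod (ell2_nth y i)"
      by (metis abs_Re_le_cmod complex_mod_cnj norm_mult)
    also have "\<dots> \<le> (cmod (ell2_nth x i))\<^sup>2 + (cmod (ell2_nth y i))\<^sup>2"
      using sum_squares_bound[of "cmod (ell2_nth x i)" "cmod (ell2_nth y i)"]
        mult_nonneg_nonneg[OF norm_ge_zero[of "ell2_nth x i"] norm_ge_zero[of "ell2_nth y i"]]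
      by linarith
    finally show "norm (Re (ell2_nth x i * cnj (ell2_nth y i)))
        \<le> (cmod (ell2_nth x i))\<^sup>2 + (cmod (ell2_nth y i))\<^sup>2" by simp
  qed
  have sq: "Re (z * cnj z) = (cmod z)\<^sup>2" for z
    unfolding cmod_power2 by (simp add: power2_eq_square)
  have inner_self: "inner x x = (\<Sum>i. (cmod (ell2_nth x i))\<^sup>2)" for x :: ell2
    by (simp only: inner_ell2_def sq)
  fix x y z :: ell2 and r s :: real
  show "x + y + z = x + (y + z)" "x + y = y + x" "0 + x = x" "- x + x = 0"
    by (transfer; simp add: fun_eq_iff)+
  show "x - y = x + - y" by (simp add: minus_ell2_def)
  show "r *\<^sub>R (x + y) = r *\<^sub>R x + r *\<^sub>R y" "(r + s) *\<^sub>R x = r *\<^sub>R x + s *\<^sub>R x"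
    "r *\<^sub>R s *\<^sub>R x = (r * s) *\<^sub>R x" "1 *\<^sub>R x = x"
    unfolding scaleR_ell2_def by (transfer; simp add: fun_eq_iff algebra_simps)+
  show "dist x y = norm (x - y)" "sgn x = inverse (norm x) *\<^sub>R x"
    "(uniformity :: (ell2 \<times> ell2) filter) = (INF e\<in>{0<..}. principal {(x, y). dist x y < e})"
    by (simp_all add: dist_ell2_def sgn_ell2_def uniformity_ell2_def)
  show "open U = (\<forall>x\<in>U. \<forall>\<^sub>F (x', y) in uniformity. x' = x \<longrightarrow> y \<in> U)" for U :: "ell2 set"
    by (rule open_ell2_def)
  show "inner x y = inner y x"
    by (simp add: inner_ell2_def algebra_simps)
  show "inner (x + y) z = inner x z + inner y z"
    using summ by (simp add: inner_ell2_def plus_ell2.rep_eq suminf_add algebra_simps)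
  show "inner (r *\<^sub>R x) y = r * inner x y"
    using summ[of x y]
    by (simp add: inner_ell2_def scaleR_ell2_def ell2_cscale.rep_eq suminf_mult[symmetric]
        algebra_simps)
  show "0 \<le> inner x x"
    unfolding inner_self by (intro suminf_nonneg summable_cmod_square) simp
  show "inner x x = 0 \<longleftrightarrow> x = 0"
  proof -
    have "inner x x = 0 \<longleftrightarrow> (\<forall>i. (cmod (ell2_nth x i))\<^sup>2 = 0)"
      unfolding inner_self by (intro suminf_eq_zero_iff summable_cmod_square) simp
    also have "\<dots> \<longleftrightarrow> x = 0"
      by (simp add: ell2_nth_inject[symmetric] zero_ell2.rep_eq fun_eq_iff)
    finally show ?thesis .
  qed
  show "norm x = sqrt (inner x x)"
    by (simp add: norm_ell2_def inner_self)
qed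

end

section \<open>Spectrum and resolvent\<close>

definition shifted_op :: "(ell2 \<Rightarrow> ell2) \<Rightarrow> complex \<Rightarrow> ell2 \<Rightarrow> ell2"
  where "shifted_op T w = (\<lambda>x. T x - w *\<^sub>C x)"

definition resolvent_op :: "(ell2 \<Rightarrow> ell2) \<Rightarrow> complex \<Rightarrow> ell2 \<Rightarrow> ell2"
  where "resolvent_op T w = inv (shifted_op T w)"

text \<open>For complex-linear \<open>T\<close>, the inverse of a bijective \<open>shifted_op T w\<close> is automatically
  complex-linear, so requiring real linearity in \<^const>\<open>bounded_linear\<close> loses nothing.\<close>

definition resolvent_set :: "(ell2 \<Rightarrow> ell2) \<Rightarrow> complex set"
  where "resolvent_set T = {w. bij (shifted_op T w) \<and> bounded_linear (resolvent_op T w)}"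

definition spectrum :: "(ell2 \<Rightarrow> ell2) \<Rightarrow> complex set"
  where "spectrum T = - resolvent_set T"

section \<open>Toeplitz operators\<close>

text \<open>Symbols are functions on the complex plane of which only the values on the unit circle
  matter.\<close>

definition fourier_coeff :: "(complex \<Rightarrow> complex) \<Rightarrow> int \<Rightarrow> complex"
  where "fourier_coeff f n =
    1 / (2 * pi) * integral {0..2 * pi} (\<lambda>\<theta>. f (cis \<theta>) * cis (- (of_int n * \<theta>)))"

definition toeplitz_seq :: "(complex \<Rightarrow> complex) \<Rightarrow> (nat \<Rightarrow> complex) \<Rightarrow> nat \<Rightarrow> complex"
  where "toeplitz_seq f x i = (\<Sum>j. fourier_coeff f (int i - int j) * x j)"

text \<open>Rows and columns are numbered from \<open>0\<close>, which leaves the differences \<open>i - j\<close> unchanged.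
  \<^const>\<open>Abs_ell2\<close> is meaningful here by \<open>ell2_nth_toeplitz\<close> below, at least for symbols with
  absolutely summable Fourier coefficients.\<close>

definition toeplitz :: "(complex \<Rightarrow> complex) \<Rightarrow> ell2 \<Rightarrow> ell2"
  where "toeplitz f x = Abs_ell2 (toeplitz_seq f (ell2_nth x))"

lemma square_summable_convolution:
  fixes a :: "int \<Rightarrow> complex" and x :: "nat \<Rightarrow> complex"
  assumes a: "(\<lambda>n. cmod (a n)) summable_on UNIV" and x: "summable (\<lambda>j. (cmod (x j))\<^sup>2)"
  shows "summable (\<lambda>j. a (int i - int j) * x j)"
    and "summable (\<lambda>i. (cmod (\<Sum>j. a (int i - int j) * x j))\<^sup>2)"
proof -
  define A where "A = (\<Sum>\<^sub>\<infinity>n. cmod (a n))"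
  define X where "X = (\<Sum>j. (cmod (x j))\<^sup>2)"
  have fin: "(\<Sum>n\<in>F. cmod (a n)) \<le> A" if "finite F" for F
    unfolding A_def by (rule finite_sum_le_infsum[OF a that]) auto
  have A0: "A \<ge> 0" unfolding A_def by (rule infsum_nonneg) simp
  have row: "(\<Sum>j<M. cmod (a (int i - int j))) \<le> A" for i M
    using fin[of "(\<lambda>j. int i - int j) ` {..<M}"] by (simp add: sum.reindex inj_on_def)
  have col: "(\<Sum>i<N. cmod (a (int i - int j))) \<le> A" for j N
    using fin[of "(\<lambda>i. int i - int j) ` {..<N}"] by (simp add: sum.reindex inj_on_def)
  have sumX: "(\<Sum>j<M. (cmod (x j))\<^sup>2) \<le> X" for M
    unfolding X_def by (rule sum_le_suminf[OF x]) auto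
  have main: "(\<Sum>i<N. (\<Sum>j<M. cmod (a (int i - int j)) * cmod (x j))\<^sup>2) \<le> A * (A * X)" for N M
  proof -
    have "(\<Sum>j<M. cmod (a (int i - int j)) * cmod (x j))\<^sup>2
        \<le> A * (\<Sum>j<M. cmod (a (int i - int j)) * (cmod (x j))\<^sup>2)" for i
    proof -
      let ?u = "\<lambda>j. sqrt (cmod (a (int i - int j)))"
      have "(\<Sum>j<M. ?u j * (?u j * cmod (x j)))\<^sup>2
          \<le> (\<Sum>j<M. (?u j)\<^sup>2) * (\<Sum>j<M. (?u j * cmod (x j))\<^sup>2)"
        by (rule Cauchy_Schwarz_ineq_sum)
      then have "(\<Sum>j<M. cmod (a (int i - int j)) * cmod (x j))\<^sup>2
          \<le> (\<Sum>j<M. cmod (a (int i - int j))) * (\<Sum>j<M. cmod (a (int i - int j)) * (cmod (x j))\<^sup>2)"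
        by (simp add: power_mult_distrib flip: mult.assoc)
      also have "\<dots> \<le> A * (\<Sum>j<M. cmod (a (int i - int j)) * (cmod (x j))\<^sup>2)"
        by (intro mult_right_mono row sum_nonneg) auto
      finally show ?thesis .
    qed
    then have "(\<Sum>i<N. (\<Sum>j<M. cmod (a (int i - int j)) * cmod (x j))\<^sup>2)
        \<le> (\<Sum>i<N. A * (\<Sum>j<M. cmod (a (int i - int j)) * (cmod (x j))\<^sup>2))"
      by (intro sum_mono)
    also have "\<dots> = A * (\<Sum>i<N. \<Sum>j<M. cmod (a (int i - int j)) * (cmod (x j))\<^sup>2)"
      by (simp add: sum_distrib_left)
    also have "\<dots> = A * (\<Sum>j<M. (\<Sum>i<N. cmod (a (int i - int j))) * (cmod (x j))\<^sup>2)"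
      by (subst sum.swap) (simp add: sum_distrib_right)
    also have "\<dots> \<le> A * (\<Sum>j<M. A * (cmod (x j))\<^sup>2)"
      by (intro mult_left_mono sum_mono mult_right_mono col A0) auto
    also have "\<dots> = A * (A * (\<Sum>j<M. (cmod (x j))\<^sup>2))"
      by (simp add: sum_distrib_left)
    also have "\<dots> \<le> A * (A * X)"
      by (intro mult_left_mono sumX A0)
    finally show ?thesis .
  qed
  have abs_summable: "summable (\<lambda>j. cmod (a (int i - int j) * x j))" for i
  proof (rule summableI_nonneg_bounded)
    fix M
    let ?s = "\<lambda>i. \<Sum>j<M. cmod (a (int i - int j)) * cmod (x j)"
    have "(?s i)\<^sup>2 \<le> (\<Sum>i<Suc i. (?s i)\<^sup>2)"
      by (rule member_le_sum) auto
    also have "\<dots> \<le> A * (A * X)" by (rule main)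
    finally show "(\<Sum>j<M. cmod (a (int i - int j) * x j)) \<le> sqrt (A * (A * X))"
      by (simp add: norm_mult real_le_rsqrt)
  qed simp
  show "summable (\<lambda>j. a (int i - int j) * x j)"
    by (rule summable_norm_cancel[OF abs_summable])
  show "summable (\<lambda>i. (cmod (\<Sum>j. a (int i - int j) * x j))\<^sup>2)"
  proof (rule summableI_nonneg_bounded)
    fix N
    have "(\<lambda>M. \<Sum>i<N. (cmod (\<Sum>j<M. a (int i - int j) * x j))\<^sup>2)
        \<longlonglongrightarrow> (\<Sum>i<N. (cmod (\<Sum>j. a (int i - int j) * x j))\<^sup>2)"
      by (intro tendsto_intros summable_LIMSEQ summable_norm_cancel[OF abs_summable])
    moreover have "(\<Sum>i<N. (cmod (\<Sum>j<M. a (int i - int j) * x j))\<^sup>2) \<le> A * (A * X)" for M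
    proof -
      have "(\<Sum>i<N. (cmod (\<Sum>j<M. a (int i - int j) * x j))\<^sup>2)
          \<le> (\<Sum>i<N. (\<Sum>j<M. cmod (a (int i - int j)) * cmod (x j))\<^sup>2)"
        by (intro sum_mono power_mono sum_norm_le) (auto simp: norm_mult)
      also have "\<dots> \<le> A * (A * X)" by (rule main)
      finally show ?thesis .
    qed
    ultimately show "(\<Sum>i<N. (cmod (\<Sum>j. a (int i - int j) * x j))\<^sup>2) \<le> A * (A * X)"
      by (intro LIMSEQ_le_const2) auto
  qed simp
qed

lemma ell2_nth_toeplitz:
  assumes "(\<lambda>n. cmod (fourier_coeff f n)) summable_on UNIV"
  shows "ell2_nth (toeplitz f x) i = (\<Sum>j. fourier_coeff f (int i - int j) * ell2_nth x j)"
  using square_summable_convolution(2)[OF assms summable_cmod_square[of x]]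
  by (simp add: toeplitz_def toeplitz_seq_def Abs_ell2_inverse)

end

theory Submission
  imports Defs "HOL-Complex_Analysis.Cauchy_Integral_Formula"
begin

text \<open>
  Multiplication by \<open>z\<close> turns the symbol into the power series \<open>A(z) = z b(z)\<close>, with
  \<open>A\<^sub>n = b\<^sub>n\<^sub>-\<^sub>1\<close>, and turns the weight into \<open>\<Sum> n |A\<^sub>n| < \<infinity>\<close>. Identify a square-summable sequence with its
  generating power series. Then \<open>(T\<^sub>b - w) x\<close> has the \<open>i\<close>-th entry \<open>(G x)\<^sub>i\<^sub>+\<^sub>1\<close>, where
  \<open>G(z) = A(z) - w z = z (b(z) - w)\<close>: multiply by \<open>G\<close>, then drop the constant term. So the
  resolvent can be read off from \<open>G\<close>. Let \<open>d\<close> be the distance from \<open>w\<close> to the spectrum.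

  If \<open>G\<close> vanishes at a point of the circle, then \<open>G = (z - a) Q\<close> with \<open>Q\<close> absolutely summable, and long
  geometric sums show that \<open>T\<^sub>b - w\<close> is not bounded below (\<open>circle_root_in_spectrum\<close>). So \<open>b\<close> maps
  the circle into the spectrum, and \<open>|G| \<ge> d\<close> on the circle.

  If \<open>w\<close> is in the resolvent set, then \<open>G\<close> has a root \<open>a\<close> in the open disc: otherwise \<open>1 / G\<close> is bounded
  and analytic, its coefficients are square-summable, and it lies in the kernel of \<open>T\<^sub>b - w\<close>
  (\<open>resolvent_imp_disc_root\<close>).

  Write \<open>G = (z - a) Q\<close>, \<open>u = Q x\<close> and \<open>h = (T\<^sub>b - w) x\<close>. Then \<open>h\<^sub>i = u\<^sub>i - a u\<^sub>i\<^sub>+\<^sub>1\<close>, hence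
  \<open>(1 - |a|) \<parallel>u\<parallel> \<le> \<parallel>h\<parallel>\<close>. On the circle \<open>|Q| = |G| / |z - a| \<ge> d / 2\<close>, and multiplication by \<open>Q\<close> scales
  norms by at least the minimum of \<open>|Q|\<close> on the circle (\<open>partial_norm_mult_ge\<close>), hence
  \<open>d / 2 \<parallel>x\<parallel> \<le> \<parallel>u\<parallel>\<close>. Together
  \<open>\<parallel>x\<parallel> \<le> 2 / (d (1 - |a|)) \<parallel>h\<parallel>\<close> (\<open>a_priori_estimate\<close>).

  It remains to keep \<open>a\<close> away from the circle (\<open>disc_root_margin\<close>). If \<open>|a| \<le> 1/2\<close> there is nothing to
  do. Otherwise \<open>w = b(a)\<close>, and the weight makes \<open>b\<close> Lipschitz on \<open>1/2 \<le> |z| \<le> 1\<close>, so that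
  \<open>d \<le> |b(a / |a|) - b(a)| \<le> M (1 - |a|)\<close>. In both cases \<open>1 / (1 - |a|) \<le> 2 + M / d\<close>, which is the second
  factor of the bound.
\<close>

unbundle fps_syntax
unbundle no vec_syntax

section \<open>Truncated square norms of formal power series\<close>

text \<open>
  Truncating the square norm makes it finite for every power series, so that series and sequences can
  be multiplied freely before it is known that they are square-summable. Square-summability with
  norm at most \<open>K\<close> is the statement that all truncated norms are at most \<open>K\<close>.
\<close>
definition partial_norm :: "nat \<Rightarrow> complex fps \<Rightarrow> real"
  where "partial_norm N F = L2_set (\<lambda>i. cmod (F $ i)) {..<N}"

lemma partial_norm_nonneg [simp]: "0 \<le> partial_norm N F"
  by (simp add: partial_norm_def)

lemma partial_norm_0 [simp]: "partial_norm N 0 = 0"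
  by (simp add: partial_norm_def L2_set_eq_0_iff)

lemma partial_norm_cong: "(\<And>i. i < N \<Longrightarrow> F $ i = G $ i) \<Longrightarrow> partial_norm N F = partial_norm N G"
  unfolding partial_norm_def by (rule L2_set_cong) auto

lemma partial_norm_le:
  "(\<And>i. i < N \<Longrightarrow> cmod (F $ i) \<le> cmod (G $ i)) \<Longrightarrow> partial_norm N F \<le> partial_norm N G"
  unfolding partial_norm_def by (rule L2_set_mono) auto

lemma partial_norm_power2: "(partial_norm N F)\<^sup>2 = (\<Sum>i<N. (cmod (F $ i))\<^sup>2)"
  by (simp add: partial_norm_def L2_set_def sum_nonneg)

lemma partial_norm_mono: "N \<le> M \<Longrightarrow> partial_norm N F \<le> partial_norm M F"
  unfolding partial_norm_def L2_set_def
  by (intro real_sqrt_le_mono sum_mono2) auto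

lemma partial_norm_add: "partial_norm N (F + G) \<le> partial_norm N F + partial_norm N G"
proof -
  have "partial_norm N (F + G) \<le> L2_set (\<lambda>i. cmod (F $ i) + cmod (G $ i)) {..<N}"
    unfolding partial_norm_def by (rule L2_set_mono) (auto intro: norm_triangle_ineq)
  also have "\<dots> \<le> partial_norm N F + partial_norm N G"
    unfolding partial_norm_def by (rule L2_set_triangle_ineq)
  finally show ?thesis .
qed

lemma partial_norm_minus [simp]: "partial_norm N (- F) = partial_norm N F"
  by (simp add: partial_norm_def)

lemma partial_norm_diff: "partial_norm N (F - G) \<le> partial_norm N F + partial_norm N G"
  using partial_norm_add[of N F "- G"] by simp

lemma partial_norm_sum: "partial_norm N (\<Sum>k\<in>K. F k) \<le> (\<Sum>k\<in>K. partial_norm N (F k))"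
proof (induction K rule: infinite_finite_induct)
  case (insert k K)
  then show ?case using partial_norm_add[of N "F k" "\<Sum>k\<in>K. F k"] by simp
qed auto

lemma partial_norm_const_mult: "partial_norm N (fps_const c * F) = cmod c * partial_norm N F"
  by (simp add: partial_norm_def norm_mult L2_set_right_distrib)

lemma partial_norm_X_mult: "partial_norm (Suc N) (fps_X * F) = partial_norm N F"
proof -
  have "(partial_norm (Suc N) (fps_X * F))\<^sup>2 = (partial_norm N F)\<^sup>2"
    unfolding partial_norm_power2 by (simp only: sum.lessThan_Suc_shift) simp
  then show ?thesis by (simp add: power2_eq_iff_nonneg)
qed

lemma partial_norm_X_power_mult_le: "partial_norm N (fps_X ^ k * F) \<le> partial_norm N F"
proof (induction k)
  case (Suc k)
  have "partial_norm N (fps_X ^ Suc k * F) \<le> partial_norm (Suc N) (fps_X * (fps_X ^ k * F))"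
    by (simp add: mult.assoc partial_norm_mono)
  with Suc show ?case by (simp add: partial_norm_X_mult)
qed simp

lemma partial_norm_1_le: "partial_norm N 1 \<le> 1"
proof -
  have "(partial_norm N 1)\<^sup>2 \<le> 1\<^sup>2"
    by (cases N) (simp_all add: partial_norm_power2 sum.lessThan_Suc_shift del: sum.lessThan_Suc)
  then show ?thesis by (rule power2_le_imp_le) simp
qed

lemma partial_norm_fps_shift_le: "partial_norm N (fps_shift 1 F) \<le> partial_norm (Suc N) F"
proof -
  have "partial_norm N (fps_shift 1 F) = partial_norm (Suc N) (fps_X * fps_shift 1 F)"
    by (rule partial_norm_X_mult[symmetric])
  also have "\<dots> \<le> partial_norm (Suc N) F" by (rule partial_norm_le) auto
  finally show ?thesis .
qed

section \<open>Power series with absolutely summable coefficients\<close>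

text \<open>The power series in the Wiener algebra of absolutely convergent Fourier series.\<close>
definition wiener :: "complex fps \<Rightarrow> bool"
  where "wiener F \<longleftrightarrow> summable (\<lambda>n. cmod (F $ n))"

definition wiener_norm :: "complex fps \<Rightarrow> real"
  where "wiener_norm F = (\<Sum>n. cmod (F $ n))"

lemma wiener_norm_nonneg: "wiener F \<Longrightarrow> 0 \<le> wiener_norm F"
  unfolding wiener_norm_def wiener_def by (rule suminf_nonneg) auto

lemma fps_cutoff_as_sum: "fps_cutoff N F = (\<Sum>n<N. fps_const (F $ n) * fps_X ^ n)"
  by (rule fps_ext) (simp add: fps_sum_nth fps_X_power_nth if_distrib if_distribR sum.delta cong: if_cong)

text \<open>
  Young's inequality \<open>\<parallel>c * f\<parallel>\<^sub>2 \<le> \<parallel>c\<parallel>\<^sub>1 \<parallel>f\<parallel>\<^sub>2\<close>: the first \<open>N\<close> coefficients of the product only see the first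
  \<open>N\<close> terms of \<open>C\<close>, and each of these is a multiple of a shift, which does not increase the norm.
\<close>
lemma partial_norm_mult_le:
  assumes "wiener C"
  shows "partial_norm N (C * F) \<le> wiener_norm C * partial_norm N F"
proof -
  have "partial_norm N (C * F) = partial_norm N (fps_cutoff N C * F)"
    by (rule partial_norm_cong) (auto simp: fps_mult_nth intro!: sum.cong)
  also have "fps_cutoff N C * F = (\<Sum>n<N. fps_const (C $ n) * (fps_X ^ n * F))"
    by (simp add: fps_cutoff_as_sum sum_distrib_right mult.assoc)
  also have "partial_norm N \<dots> \<le> (\<Sum>n<N. cmod (C $ n) * partial_norm N (fps_X ^ n * F))"
    using partial_norm_sum[of N "\<lambda>n. fps_const (C $ n) * (fps_X ^ n * F)" "{..<N}"]
    by (simp only: partial_norm_const_mult)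
  also have "\<dots> \<le> (\<Sum>n<N. cmod (C $ n) * partial_norm N F)"
    by (intro sum_mono mult_left_mono partial_norm_X_power_mult_le) auto
  also have "\<dots> = (\<Sum>n<N. cmod (C $ n)) * partial_norm N F"
    by (simp add: sum_distrib_right)
  also have "\<dots> \<le> wiener_norm C * partial_norm N F"
    unfolding wiener_norm_def
    using assms by (intro mult_right_mono sum_le_suminf) (auto simp: wiener_def)
  finally show ?thesis .
qed

lemma partial_norm_le_wiener_norm:
  assumes "wiener F" shows "partial_norm N F \<le> wiener_norm F"
  using order_trans[OF partial_norm_mult_le[OF assms, of N 1]]
    mult_left_mono[OF partial_norm_1_le wiener_norm_nonneg[OF assms], of N] by simp

lemma wiener_summable:
  assumes "wiener F" "cmod z \<le> 1"
  shows "summable (\<lambda>n. cmod (F $ n * z ^ n))"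
  by (rule summable_comparison_test'[where N = 0, OF assms(1)[unfolded wiener_def]])
     (use assms in \<open>auto simp: norm_mult norm_power intro!: mult_left_le power_le_one\<close>)

lemma wiener_sums:
  assumes "wiener F" "cmod z \<le> 1"
  shows "(\<lambda>n. F $ n * z ^ n) sums eval_fps F z"
  using summable_norm_cancel[OF wiener_summable[OF assms]]
  by (simp add: eval_fps_def summable_sums)

text \<open>
  Absolute summability makes evaluation multiplicative on the whole closed disc, whereas the radius
  of convergence alone would only give the open disc.
\<close>
lemma wiener_eval_mult:
  assumes "wiener F" "wiener G" "cmod z \<le> 1"
  shows "eval_fps (F * G) z = eval_fps F z * eval_fps G z"
proof -
  have "(\<lambda>k. \<Sum>i\<le>k. (F $ i * z ^ i) * (G $ (k - i) * z ^ (k - i)))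
      sums (eval_fps F z * eval_fps G z)"
    unfolding eval_fps_def
    by (rule Cauchy_product_sums) (use assms wiener_summable in auto)
  also have "(\<lambda>k. \<Sum>i\<le>k. (F $ i * z ^ i) * (G $ (k - i) * z ^ (k - i)))
      = (\<lambda>k. (F * G) $ k * z ^ k)"
  proof (rule ext)
    fix k
    have eq: "(F $ i * z ^ i) * (G $ (k - i) * z ^ (k - i)) = F $ i * G $ (k - i) * z ^ k"
      if "i \<le> k" for i
    proof -
      have "(F $ i * z ^ i) * (G $ (k - i) * z ^ (k - i)) = F $ i * G $ (k - i) * (z ^ i * z ^ (k - i))"
        by (simp only: mult_ac)
      then show ?thesis using that by (simp flip: power_add)
    qed
    show "(\<Sum>i\<le>k. (F $ i * z ^ i) * (G $ (k - i) * z ^ (k - i))) = (F * G) $ k * z ^ k"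
      unfolding fps_mult_nth sum_distrib_right atLeast0AtMost
      by (intro sum.cong refl) (simp only: eq atMost_iff)
  qed
  finally show ?thesis by (simp add: eval_fps_def sums_iff)
qed

lemma wiener_norm_eval_le:
  assumes "wiener F" "cmod z \<le> 1"
  shows "cmod (eval_fps F z) \<le> wiener_norm F"
proof -
  have "cmod (eval_fps F z) \<le> (\<Sum>n. cmod (F $ n * z ^ n))"
    unfolding eval_fps_def by (rule summable_norm[OF wiener_summable[OF assms]])
  also have "\<dots> \<le> wiener_norm F"
    unfolding wiener_norm_def
    by (rule suminf_le[OF _ wiener_summable[OF assms] assms(1)[unfolded wiener_def]])
       (use assms in \<open>auto simp: norm_mult norm_power intro!: mult_left_le power_le_one\<close>)
  finally show ?thesis .
qed

lemma wiener_continuous_on: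
  assumes "wiener F"
  shows "continuous_on (cball 0 1) (eval_fps F)"
proof -
  have "uniform_limit (cball 0 1) (\<lambda>N z. \<Sum>n<N. F $ n * z ^ n) (\<lambda>z. \<Sum>n. F $ n * z ^ n) sequentially"
    by (rule Weierstrass_m_test[OF _ assms[unfolded wiener_def]])
       (auto simp: norm_mult norm_power intro!: mult_left_le power_le_one)
  then have "continuous_on (cball 0 1) (\<lambda>z. \<Sum>n. F $ n * z ^ n)"
    by (rule uniform_limit_theorem[rotated]) (auto intro!: always_eventually continuous_intros)
  then show ?thesis by (simp add: eval_fps_def[abs_def])
qed

lemma wiener_of_poly [simp]: "wiener (fps_of_poly p)"
  unfolding wiener_def by (rule summable_finite[of "{..degree p}"]) (auto simp: coeff_eq_0)

lemma wiener_diff: "wiener F \<Longrightarrow> wiener G \<Longrightarrow> wiener (F - G)"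
  unfolding wiener_def
  by (rule summable_comparison_test'[where N = 0 and g = "\<lambda>n. cmod (F $ n) + cmod (G $ n)"])
     (auto intro: summable_add norm_triangle_ineq4)

lemma wiener_eval_diff:
  assumes "wiener F" "wiener G" "cmod z \<le> 1"
  shows "eval_fps (F - G) z = eval_fps F z - eval_fps G z"
  using sums_diff[OF wiener_sums[OF assms(1,3)] wiener_sums[OF assms(2,3)]]
  by (simp add: eval_fps_def sums_iff left_diff_distrib)

section \<open>Multiplication by a series that is bounded below on the circle\<close>

lemma roots_of_unity_orthogonal:
  assumes "n < N" "m < N"
  defines "\<omega> \<equiv> \<lambda>k. cis (2 * pi * real k / real N)"
  shows "(\<Sum>k<N. \<omega> k ^ n * cnj (\<omega> k ^ m)) = (if n = m then of_nat N else 0)"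
proof -
  define \<zeta> where "\<zeta> = cis (2 * pi * (real n - real m) / real N)"
  have N: "N > 0" using assms by simp
  have powers: "\<omega> k ^ n * cnj (\<omega> k ^ m) = \<zeta> ^ k" for k
  proof -
    have "\<omega> k ^ n * cnj (\<omega> k ^ m)
        = cis (real n * (2 * pi * real k / real N) + - (real m * (2 * pi * real k / real N)))"
      by (simp only: \<omega>_def Complex.DeMoivre cis_cnj cis_mult)
    also have "real n * (2 * pi * real k / real N) + - (real m * (2 * pi * real k / real N))
        = real k * (2 * pi * (real n - real m) / real N)"
      by (simp add: diff_divide_distrib algebra_simps)
    also have "cis \<dots> = \<zeta> ^ k"
      by (simp only: \<zeta>_def Complex.DeMoivre)
    finally show ?thesis .
  qed
  have "\<zeta> ^ N = cis (2 * pi * of_int (int n - int m))"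
    using N by (simp add: \<zeta>_def Complex.DeMoivre)
  then have pow: "\<zeta> ^ N = 1"
    by (metis Ints_of_int cis_multiple_2pi)
  show ?thesis
  proof (cases "n = m")
    case True
    then show ?thesis unfolding powers by (simp add: \<zeta>_def)
  next
    case False
    have "\<zeta> \<noteq> 1"
    proof
      assume "\<zeta> = 1"
      then obtain j :: int where j: "2 * pi * (real n - real m) / real N = of_int j * (2 * pi)"
        by (auto simp: \<zeta>_def complex_eq_iff cos_one_2pi_int mult_ac)
      then have "2 * pi * (real n - real m) = 2 * pi * (of_int j * real N)"
        using N by (simp add: field_simps)
      then have "real n - real m = of_int j * real N" by simp
      then have "real_of_int (int n - int m) = of_int (j * int N)" by simp
      then have "int n - int m = j * int N" by (simp only: of_int_eq_iff)
      then have "int N dvd int n - int m" by simp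
      then show False
        using assms(1,2) False zdvd_imp_le[of "int N" "\<bar>int n - int m\<bar>"] by fastforce
    qed
    then show ?thesis
      using False pow unfolding powers by (simp add: geometric_sum)
  qed
qed

text \<open>
  For polynomials the square norm is an average of values at roots of unity, once there are more
  roots than the degree. This finite form of Parseval's identity suffices because square-summable
  sequences are limits of their truncations.
\<close>
lemma discrete_Parseval:
  assumes "degree p < N"
  shows "(\<Sum>k<N. (cmod (poly p (cis (2 * pi * real k / real N))))\<^sup>2)
    = real N * (\<Sum>n<N. (cmod (coeff p n))\<^sup>2)"
proof -
  let ?w = "\<lambda>k. cis (2 * pi * real k / real N)"
  have p: "poly p z = (\<Sum>n<N. coeff p n * z ^ n)" for z
  proof -
    have "poly p z = (\<Sum>n\<le>degree p. coeff p n * z ^ n)" by (rule poly_altdef)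
    also have "\<dots> = (\<Sum>n<N. coeff p n * z ^ n)"
      using assms by (intro sum.mono_neutral_left) (auto simp: coeff_eq_0)
    finally show ?thesis .
  qed
  have "complex_of_real (\<Sum>k<N. (cmod (poly p (?w k)))\<^sup>2)
      = (\<Sum>k<N. poly p (?w k) * cnj (poly p (?w k)))"
    by (simp only: of_real_sum complex_norm_square)
  also have "\<dots> = (\<Sum>k<N. \<Sum>n<N. \<Sum>m<N. coeff p n * cnj (coeff p m) * (?w k ^ n * cnj (?w k ^ m)))"
  proof (rule sum.cong[OF refl])
    fix k
    have "poly p z * cnj (poly p z)
        = (\<Sum>n<N. \<Sum>m<N. coeff p n * cnj (coeff p m) * (z ^ n * cnj (z ^ m)))" for z
      unfolding p cnj_sum sum_product by (intro sum.cong refl) (simp add: mult_ac)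
    then show "poly p (?w k) * cnj (poly p (?w k))
        = (\<Sum>n<N. \<Sum>m<N. coeff p n * cnj (coeff p m) * (?w k ^ n * cnj (?w k ^ m)))" .
  qed
  also have "\<dots> = (\<Sum>n<N. \<Sum>m<N. \<Sum>k<N. coeff p n * cnj (coeff p m) * (?w k ^ n * cnj (?w k ^ m)))"
    by (subst sum.swap) (intro sum.cong refl sum.swap)
  also have "\<dots> = (\<Sum>n<N. \<Sum>m<N. coeff p n * cnj (coeff p m) * (if n = m then of_nat N else 0))"
    by (intro sum.cong refl) (simp only: sum_distrib_left[symmetric] roots_of_unity_orthogonal lessThan_iff)
  also have "\<dots> = (\<Sum>n<N. coeff p n * cnj (coeff p n) * of_nat N)"
    by (intro sum.cong refl) (simp add: if_distrib sum.delta' cong: if_cong)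
  also have "\<dots> = complex_of_real (real N * (\<Sum>n<N. (cmod (coeff p n))\<^sup>2))"
    by (simp add: complex_norm_square[symmetric] sum_distrib_left mult.commute)
  finally show ?thesis by (simp only: of_real_eq_iff)
qed

lemma partial_norm_of_poly:
  assumes "degree p < N"
  shows "real N * (partial_norm N (fps_of_poly p))\<^sup>2
    = (\<Sum>k<N. (cmod (poly p (cis (2 * pi * real k / real N))))\<^sup>2)"
  using discrete_Parseval[OF assms] by (simp add: partial_norm_power2)

text \<open>
  For polynomials the lower bound holds pointwise at every root of unity; the condition on \<open>N\<close> leaves
  room for the degree of the product. Negative \<open>m\<close> is admitted because truncation
  may push a small lower bound below zero.
\<close>
lemma partial_norm_poly_mult_ge:
  assumes deg: "degree p + degree q < N"
    and ge: "\<And>z. cmod z = 1 \<Longrightarrow> m \<le> cmod (poly p z)"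
  shows "m * partial_norm N (fps_of_poly q) \<le> partial_norm N (fps_of_poly (p * q))"
proof (cases "0 \<le> m")
  case False
  then have "m * partial_norm N (fps_of_poly q) \<le> 0" by (simp add: mult_nonpos_nonneg)
  then show ?thesis by (meson order_trans partial_norm_nonneg)
next
  case True
  let ?w = "\<lambda>k. cis (2 * pi * real k / real N)"
  have N: "real N > 0" using deg by simp
  have "real N * (m * partial_norm N (fps_of_poly q))\<^sup>2
      = (\<Sum>k<N. m\<^sup>2 * (cmod (poly q (?w k)))\<^sup>2)"
    using partial_norm_of_poly[of q N] deg
    by (simp add: power_mult_distrib sum_distrib_left[symmetric] mult.left_commute)
  also have "\<dots> \<le> (\<Sum>k<N. (cmod (poly (p * q) (?w k)))\<^sup>2)"
    by (intro sum_mono) (auto simp: norm_mult power_mult_distrib intro!: mult_right_mono power_mono ge True)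
  also have "\<dots> = real N * (partial_norm N (fps_of_poly (p * q)))\<^sup>2"
    using deg degree_mult_le[of p q] by (subst partial_norm_of_poly) auto
  finally have "(m * partial_norm N (fps_of_poly q))\<^sup>2 \<le> (partial_norm N (fps_of_poly (p * q)))\<^sup>2"
    using N by (simp only: mult_le_cancel_left_pos)
  then show ?thesis by (rule power2_le_imp_le) simp
qed

lemma wiener_cutoff [simp]: "wiener (fps_cutoff N F)"
  unfolding fps_of_poly_truncate[symmetric] by (rule wiener_of_poly)

lemma wiener_norm_cutoff_tendsto:
  assumes "wiener F"
  shows "(\<lambda>N. wiener_norm (F - fps_cutoff N F)) \<longlonglongrightarrow> 0"
proof -
  have "wiener_norm (F - fps_cutoff N F) = wiener_norm F - (\<Sum>n<N. cmod (F $ n))" for N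
  proof -
    have "wiener_norm (F - fps_cutoff N F) = (\<Sum>n. cmod (F $ n) - cmod (fps_cutoff N F $ n))"
      unfolding wiener_norm_def by (rule suminf_cong) simp
    also have "\<dots> = wiener_norm F - (\<Sum>n. cmod (fps_cutoff N F $ n))"
      unfolding wiener_norm_def
      by (rule suminf_diff[symmetric]) (use assms wiener_cutoff[of N F] in \<open>simp_all only: wiener_def\<close>)
    also have "(\<Sum>n. cmod (fps_cutoff N F $ n)) = (\<Sum>n<N. cmod (fps_cutoff N F $ n))"
      by (rule suminf_finite) auto
    finally show ?thesis by simp
  qed
  moreover have "(\<lambda>N. wiener_norm F - (\<Sum>n<N. cmod (F $ n))) \<longlonglongrightarrow> wiener_norm F - wiener_norm F"
    unfolding wiener_norm_def
    using assms by (intro tendsto_intros summable_LIMSEQ) (simp add: wiener_def)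
  ultimately show ?thesis by simp
qed

text \<open>The tails of a square-summable series tend to zero, uniformly in the truncation length \<open>N\<close>.\<close>
lemma partial_norm_diff_cutoff_tendsto:
  assumes "\<And>N. partial_norm N F \<le> L"
  obtains \<delta> :: "nat \<Rightarrow> real" where "\<delta> \<longlonglongrightarrow> 0" "\<And>N M. partial_norm N (F - fps_cutoff M F) \<le> \<delta> M"
proof
  have L: "0 \<le> L" using assms[of 0] partial_norm_nonneg[of 0 F] by linarith
  have summ: "summable (\<lambda>i. (cmod (F $ i))\<^sup>2)"
  proof (rule summableI_nonneg_bounded)
    show "(\<Sum>i<N. (cmod (F $ i))\<^sup>2) \<le> L\<^sup>2" for N
      unfolding partial_norm_power2[symmetric] by (rule power_mono[OF assms]) simp
  qed simp
  define S where "S = (\<Sum>i. (cmod (F $ i))\<^sup>2)"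
  define \<delta> where "\<delta> = (\<lambda>M. sqrt (S - (partial_norm M F)\<^sup>2))"
  have "(\<lambda>M. sqrt (S - (partial_norm M F)\<^sup>2)) \<longlonglongrightarrow> sqrt (S - S)"
    unfolding partial_norm_power2 S_def by (intro tendsto_intros summable_LIMSEQ summ)
  then show "\<delta> \<longlonglongrightarrow> 0" by (simp add: \<delta>_def)
  fix N M :: nat
  let ?K = "max N M"
  have "(partial_norm N (F - fps_cutoff M F))\<^sup>2 \<le> (partial_norm ?K (F - fps_cutoff M F))\<^sup>2"
    by (intro power_mono partial_norm_mono) auto
  moreover have "(partial_norm M F)\<^sup>2 \<le> (partial_norm ?K (fps_cutoff M F))\<^sup>2"
  proof (intro power_mono)
    have "partial_norm M F = partial_norm M (fps_cutoff M F)" by (rule partial_norm_cong) simp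
    also have "\<dots> \<le> partial_norm ?K (fps_cutoff M F)" by (rule partial_norm_mono) simp
    finally show "partial_norm M F \<le> partial_norm ?K (fps_cutoff M F)" .
  qed simp
  moreover have "(partial_norm ?K (F - fps_cutoff M F))\<^sup>2 + (partial_norm ?K (fps_cutoff M F))\<^sup>2
      = (partial_norm ?K F)\<^sup>2"
    unfolding partial_norm_power2 sum.distrib[symmetric] by (rule sum.cong) auto
  moreover have "(partial_norm ?K F)\<^sup>2 \<le> S"
    unfolding partial_norm_power2 S_def by (rule sum_le_suminf[OF summ]) auto
  ultimately have "(partial_norm N (F - fps_cutoff M F))\<^sup>2 \<le> S - (partial_norm M F)\<^sup>2" by linarith
  then show "partial_norm N (F - fps_cutoff M F) \<le> \<delta> M"
    unfolding \<delta>_def by (rule real_le_rsqrt)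
qed

text \<open>
  Both factors are truncated and \<open>partial_norm_poly_mult_ge\<close> is applied to the truncations; Young's
  inequality controls the errors. Square-summability of \<open>F\<close> is essential: for
  \<open>C = 1 - 2 z\<close> the series \<open>F = 1 / C\<close> grows geometrically although \<open>C F = 1\<close> and \<open>|C| \<ge> 1\<close> on the circle.
\<close>
lemma partial_norm_mult_ge:
  assumes C: "wiener C" and "0 \<le> m" and ge: "\<And>z. cmod z = 1 \<Longrightarrow> m \<le> cmod (eval_fps C z)"
    and L: "\<And>N. partial_norm N F \<le> L" and K: "\<And>N. partial_norm N (C * F) \<le> K"
  shows "m * partial_norm N F \<le> K"
proof -
  define \<epsilon> where "\<epsilon> = (\<lambda>M. wiener_norm (C - fps_cutoff M C))"
  have \<epsilon>_lim: "\<epsilon> \<longlonglongrightarrow> 0" unfolding \<epsilon>_def by (rule wiener_norm_cutoff_tendsto[OF C])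
  have \<epsilon>_nonneg: "0 \<le> \<epsilon> M" for M
    unfolding \<epsilon>_def by (intro wiener_norm_nonneg wiener_diff C wiener_cutoff)
  obtain \<delta> where \<delta>_lim: "\<delta> \<longlonglongrightarrow> 0" and \<delta>: "\<And>N M. partial_norm N (F - fps_cutoff M F) \<le> \<delta> M"
    using partial_norm_diff_cutoff_tendsto[OF L] by blast
  have bound: "m * partial_norm N F \<le> K + wiener_norm C * \<delta> M + 2 * \<epsilon> M * L" if M: "M \<ge> Suc N" for M
  proof -
    let ?C = "fps_cutoff M C" and ?F = "fps_cutoff M F" and ?P = "partial_norm (2 * M)"
    have F_le: "?P ?F \<le> L"
      using partial_norm_le[of "2 * M" ?F F] L[of "2 * M"] by fastforce
    have "(m - \<epsilon> M) * ?P ?F \<le> ?P (?C * ?F)"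
    proof -
      have "m - \<epsilon> M \<le> cmod (poly (truncate_fps M C) z)" if z: "cmod z = 1" for z
      proof -
        have "cmod (eval_fps C z - eval_fps ?C z) \<le> \<epsilon> M"
          using wiener_norm_eval_le[OF wiener_diff[OF C wiener_cutoff], of z M C] z
          by (simp add: wiener_eval_diff C \<epsilon>_def)
        moreover have "eval_fps ?C z = poly (truncate_fps M C) z"
          by (simp flip: fps_of_poly_truncate)
        ultimately show ?thesis
          using ge[OF z] norm_triangle_ineq2[of "eval_fps C z" "eval_fps ?C z"] by simp
      qed
      then have "(m - \<epsilon> M) * ?P (fps_of_poly (truncate_fps M F))
          \<le> ?P (fps_of_poly (truncate_fps M C * truncate_fps M F))"
        using degree_truncate_fps[of M C] degree_truncate_fps[of M F] M
        by (intro partial_norm_poly_mult_ge) auto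
      then show ?thesis by (simp add: fps_of_poly_mult)
    qed
    also have "?C * ?F = C * F - (C * (F - ?F) + (C - ?C) * ?F)" by (simp add: algebra_simps)
    also have "?P \<dots> \<le> ?P (C * F) + ?P (C * (F - ?F) + (C - ?C) * ?F)" by (rule partial_norm_diff)
    also have "\<dots> \<le> ?P (C * F) + (?P (C * (F - ?F)) + ?P ((C - ?C) * ?F))"
      by (intro add_left_mono partial_norm_add)
    also have "?P (C * (F - ?F)) \<le> wiener_norm C * \<delta> M"
      by (rule order_trans[OF partial_norm_mult_le[OF C]])
         (intro mult_left_mono \<delta> wiener_norm_nonneg C)
    also have "?P ((C - ?C) * ?F) \<le> \<epsilon> M * L"
      unfolding \<epsilon>_def by (rule order_trans[OF partial_norm_mult_le[OF wiener_diff[OF C wiener_cutoff]]])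
         (intro mult_left_mono F_le wiener_norm_nonneg C wiener_diff wiener_cutoff)
    finally have 1: "(m - \<epsilon> M) * ?P ?F \<le> K + (wiener_norm C * \<delta> M + \<epsilon> M * L)"
      using K[of "2 * M"] by linarith
    have "partial_norm N F = partial_norm N ?F" by (rule partial_norm_cong) (use M in simp)
    also have "\<dots> \<le> ?P ?F" by (rule partial_norm_mono) (use M in simp)
    finally have "m * partial_norm N F \<le> m * ?P ?F" using \<open>0 \<le> m\<close> by (rule mult_left_mono)
    moreover have "\<epsilon> M * ?P ?F \<le> \<epsilon> M * L" by (rule mult_left_mono[OF F_le \<epsilon>_nonneg])
    ultimately show ?thesis using 1 by (simp add: algebra_simps)
  qed
  have "(\<lambda>M. K + wiener_norm C * \<delta> M + 2 * \<epsilon> M * L) \<longlonglongrightarrow> K + wiener_norm C * 0 + 2 * 0 * L"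
    by (intro tendsto_intros \<delta>_lim \<epsilon>_lim)
  then have "(\<lambda>M. K + wiener_norm C * \<delta> M + 2 * \<epsilon> M * L) \<longlonglongrightarrow> K" by simp
  then show ?thesis
    by (rule LIMSEQ_le_const) (use bound in \<open>auto intro!: exI[of _ "Suc N"]\<close>)
qed

section \<open>Dividing out a root in the closed disc\<close>

text \<open>
  Summability of the termwise derivative on the circle. It makes the sum of the series Lipschitz on
  the closed disc, and it keeps the quotient by a root on the circle inside the Wiener algebra.
\<close>
definition weighted :: "complex fps \<Rightarrow> bool"
  where "weighted F \<longleftrightarrow> summable (\<lambda>n. real n * cmod (F $ n))"

definition weighted_norm :: "complex fps \<Rightarrow> real"
  where "weighted_norm F = (\<Sum>n. real n * cmod (F $ n))"

lemma weighted_norm_nonneg: "weighted F \<Longrightarrow> 0 \<le> weighted_norm F"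
  unfolding weighted_def weighted_norm_def by (rule suminf_nonneg) auto

lemma weighted_imp_wiener:
  assumes "weighted F" shows "wiener F"
  unfolding wiener_def
  by (rule summable_comparison_test'[where N = 1, OF assms[unfolded weighted_def]])
     (auto simp: mult_le_cancel_right1)

lemma weighted_Lipschitz:
  assumes F: "weighted F" and z: "cmod z \<le> 1" and w: "cmod w \<le> 1"
  shows "cmod (eval_fps F z - eval_fps F w) \<le> weighted_norm F * cmod (z - w)"
proof -
  note W = weighted_imp_wiener[OF F]
  let ?d = "\<lambda>n. F $ n * z ^ n - F $ n * w ^ n"
  have sums: "?d sums (eval_fps F z - eval_fps F w)"
    by (intro sums_diff wiener_sums W z w)
  have le: "cmod (?d n) \<le> real n * cmod (F $ n) * cmod (z - w)" for n
    using mult_left_mono[OF norm_power_diff[OF z w, of n], of "cmod (F $ n)"]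
    by (simp add: norm_mult mult_ac flip: right_diff_distrib)
  have summ: "summable (\<lambda>n. real n * cmod (F $ n) * cmod (z - w))"
    using F by (intro summable_mult2) (simp add: weighted_def)
  have abs: "summable (\<lambda>n. cmod (?d n))"
    by (rule summable_comparison_test'[OF summ, where N = 0]) (use le in auto)
  have "cmod (eval_fps F z - eval_fps F w) = cmod (\<Sum>n. ?d n)"
    using sums by (simp add: sums_iff)
  also have "\<dots> \<le> (\<Sum>n. cmod (?d n))" by (rule summable_norm[OF abs])
  also have "\<dots> \<le> (\<Sum>n. real n * cmod (F $ n) * cmod (z - w))"
    by (rule suminf_le[OF le abs summ])
  also have "\<dots> = weighted_norm F * cmod (z - w)"
    unfolding weighted_norm_def using F by (intro suminf_mult2[symmetric]) (simp add: weighted_def)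
  finally show ?thesis .
qed

text \<open>
  The difference quotient \<open>(F(z) - F(a)) / (z - a)\<close>, expanded in powers of \<open>z\<close>.
\<close>
definition root_quotient :: "complex fps \<Rightarrow> complex \<Rightarrow> complex fps"
  where "root_quotient F a = Abs_fps (\<lambda>n. \<Sum>j. F $ (Suc n + j) * a ^ j)"

text \<open>
  The \<open>n\<close>-th coefficient is at most the tail \<open>\<Sum>\<^sub>j\<^sub>>\<^sub>n |F\<^sub>j|\<close>, and summing these tails
  over \<open>n\<close> counts \<open>|F\<^sub>j|\<close> exactly \<open>j\<close> times.
\<close>
lemma wiener_root_quotient:
  assumes F: "weighted F" and a: "cmod a \<le> 1"
  shows "wiener (root_quotient F a)"
proof -
  note W = weighted_imp_wiener[OF F]
  define T where "T = (\<lambda>n. \<Sum>j. cmod (F $ (n + j)))"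
  define U where "U = (\<lambda>n. \<Sum>j. real j * cmod (F $ (n + j)))"
  have summT: "summable (\<lambda>j. cmod (F $ (n + j)))" for n
    using W summable_iff_shift[of "\<lambda>j. cmod (F $ j)" n] by (simp add: wiener_def add.commute)
  have summU: "summable (\<lambda>j. real j * cmod (F $ (n + j)))" for n
  proof (rule summable_comparison_test'[where N = 0])
    show "summable (\<lambda>j. real (j + n) * cmod (F $ (j + n)))"
      using F unfolding weighted_def by (rule summable_ignore_initial_segment)
  qed (auto simp: add.commute intro!: mult_right_mono)
  \<comment> \<open>\<open>U n\<close> is what remains of the weighted sum after \<open>n\<close> tails have been removed, so tails telescope.\<close>
  have rec: "U n = T (Suc n) + U (Suc n)" for n
  proof -
    have "U n = (\<Sum>j. real (Suc j) * cmod (F $ (n + Suc j)))"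
      unfolding U_def by (subst suminf_split_head[OF summU]) simp
    also have "\<dots> = (\<Sum>j. cmod (F $ (Suc n + j)) + real j * cmod (F $ (Suc n + j)))"
      by (rule suminf_cong) (simp add: algebra_simps)
    also have "\<dots> = T (Suc n) + U (Suc n)"
      unfolding T_def U_def by (intro suminf_add[symmetric] summT summU)
    finally show ?thesis .
  qed
  have U_nonneg: "0 \<le> U n" for n
    unfolding U_def by (rule suminf_nonneg[OF summU]) simp
  have tele: "(\<Sum>n<N. T (Suc n)) = U 0 - U N" for N
  proof (induction N)
    case (Suc N)
    then show ?case using rec[of N] by simp
  qed simp
  have le: "cmod (root_quotient F a $ n) \<le> T (Suc n)" for n
  proof -
    have tm: "cmod (F $ (Suc n + j) * a ^ j) \<le> cmod (F $ (Suc n + j))" for j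
      using a by (simp add: norm_mult norm_power mult_left_le power_le_one)
    have abs: "summable (\<lambda>j. cmod (F $ (Suc n + j) * a ^ j))"
      by (rule summable_comparison_test'[OF summT[of "Suc n"], where N = 0]) (use tm in auto)
    have "cmod (root_quotient F a $ n) \<le> (\<Sum>j. cmod (F $ (Suc n + j) * a ^ j))"
      unfolding root_quotient_def fps_nth_Abs_fps by (rule summable_norm[OF abs])
    also have "\<dots> \<le> T (Suc n)"
      unfolding T_def by (rule suminf_le[OF tm abs summT])
    finally show ?thesis .
  qed
  show ?thesis
    unfolding wiener_def
  proof (rule summableI_nonneg_bounded)
    fix N
    have "(\<Sum>n<N. cmod (root_quotient F a $ n)) \<le> (\<Sum>n<N. T (Suc n))"
      by (intro sum_mono le)
    also have "\<dots> \<le> U 0" using tele U_nonneg by simp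
    finally show "(\<Sum>n<N. cmod (root_quotient F a $ n)) \<le> U 0" .
  qed simp
qed

lemma root_quotient_mult:
  assumes F: "wiener F" and a: "cmod a \<le> 1" and root: "eval_fps F a = 0"
  shows "F = (fps_X - fps_const a) * root_quotient F a"
proof (rule fps_ext)
  fix n
  have summ: "summable (\<lambda>j. F $ (n + j) * a ^ j)" for n
  proof (rule summable_norm_cancel, rule summable_comparison_test'[where N = 0])
    show "summable (\<lambda>j. cmod (F $ (j + n)))"
      using F unfolding wiener_def by (rule summable_ignore_initial_segment)
  qed (use a in \<open>auto simp: norm_mult norm_power add.commute mult_left_le power_le_one\<close>)
  let ?S = "\<lambda>n. \<Sum>j. F $ (n + j) * a ^ j"
  have split: "?S n = F $ n + a * ?S (Suc n)" for n
  proof -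
    have "?S n = F $ n + (\<Sum>j. F $ (n + Suc j) * a ^ Suc j)"
      by (subst suminf_split_head[OF summ]) simp
    also have "(\<Sum>j. F $ (n + Suc j) * a ^ Suc j) = (\<Sum>j. a * (F $ (Suc n + j) * a ^ j))"
      by (rule suminf_cong) (simp add: mult_ac)
    also have "\<dots> = a * ?S (Suc n)" by (rule suminf_mult[OF summ])
    finally show ?thesis .
  qed
  have "?S 0 = 0" using root by (simp add: eval_fps_def)
  then show "F $ n = ((fps_X - fps_const a) * root_quotient F a) $ n"
    using split[of n] by (cases n) (simp_all add: root_quotient_def left_diff_distrib eq_neg_iff_add_eq_0)
qed

lemma eval_root_quotient:
  assumes F: "weighted F" and a: "cmod a \<le> 1" and root: "eval_fps F a = 0" and z: "cmod z \<le> 1"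
  shows "eval_fps F z = (z - a) * eval_fps (root_quotient F a) z"
proof -
  have p: "fps_of_poly [:- a, 1:] = fps_X - fps_const a"
    by (simp add: fps_of_poly_pCons)
  have "wiener (fps_X - fps_const a)" "eval_fps (fps_X - fps_const a) z = z - a"
    unfolding p[symmetric] by simp_all
  then show ?thesis
    using wiener_eval_mult[OF _ wiener_root_quotient[OF F a] z]
      root_quotient_mult[OF weighted_imp_wiener[OF F] a root] by metis
qed

section \<open>The space of square-summable sequences\<close>

text \<open>The generating power series, for which convolution becomes multiplication.\<close>
definition ell2_fps :: "ell2 \<Rightarrow> complex fps"
  where "ell2_fps x = Abs_fps (ell2_nth x)"

lemma ell2_fps_nth [simp]: "ell2_fps x $ i = ell2_nth x i"
  by (simp add: ell2_fps_def)

lemma ell2_fps_inject: "ell2_fps x = ell2_fps y \<longleftrightarrow> x = y"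
  by (auto simp: ell2_fps_def fun_eq_iff fps_eq_iff simp flip: ell2_nth_inject)

lemma ell2_fps_0: "ell2_fps 0 = 0"
  by (rule fps_ext) (simp add: zero_ell2.rep_eq)

lemma ell2_fps_add: "ell2_fps (x + y) = ell2_fps x + ell2_fps y"
  by (rule fps_ext) (simp add: plus_ell2.rep_eq)

lemma ell2_fps_diff: "ell2_fps (x - y) = ell2_fps x - ell2_fps y"
  by (rule fps_ext)
     (unfold fps_sub_nth ell2_fps_nth minus_ell2_def plus_ell2.rep_eq uminus_ell2.rep_eq, simp)

lemma ell2_fps_cscale: "ell2_fps (c *\<^sub>C x) = fps_const c * ell2_fps x"
  by (rule fps_ext) (simp add: ell2_cscale.rep_eq)

lemma partial_norm_le_norm: "partial_norm N (ell2_fps x) \<le> norm x"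
  unfolding norm_ell2_def partial_norm_def L2_set_def ell2_fps_nth
  by (intro real_sqrt_le_mono sum_le_suminf summable_cmod_square) auto

lemma norm_le_partial_norm:
  assumes "\<And>N. partial_norm N (ell2_fps x) \<le> K"
  shows "norm x \<le> K"
proof -
  have "0 \<le> K" using assms[of 0] partial_norm_nonneg[of 0 "ell2_fps x"] by linarith
  have "(\<Sum>i. (cmod (ell2_nth x i))\<^sup>2) \<le> K\<^sup>2"
  proof (rule suminf_le_const[OF summable_cmod_square])
    show "(\<Sum>i<N. (cmod (ell2_nth x i))\<^sup>2) \<le> K\<^sup>2" for N
      using power_mono[OF assms[of N], of 2] by (simp add: partial_norm_power2)
  qed
  then have "norm x \<le> sqrt (K\<^sup>2)"
    unfolding norm_ell2_def by (rule real_sqrt_le_mono)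
  then show ?thesis using \<open>0 \<le> K\<close> by simp
qed

lemma ell2_of_fps:
  assumes "\<And>N. partial_norm N F \<le> K"
  obtains x where "ell2_fps x = F" "norm x \<le> K"
proof -
  have "summable (\<lambda>i. (cmod (F $ i))\<^sup>2)"
  proof (rule summableI_nonneg_bounded)
    show "(\<Sum>i<N. (cmod (F $ i))\<^sup>2) \<le> K\<^sup>2" for N
      unfolding partial_norm_power2[symmetric] by (rule power_mono[OF assms]) simp
  qed simp
  then have x: "ell2_fps (Abs_ell2 (\<lambda>i. F $ i)) = F"
    by (intro fps_ext) (simp add: Abs_ell2_inverse)
  show ?thesis
    by (rule that[OF x]) (rule norm_le_partial_norm, unfold x, rule assms)
qed

lemma norm_cscale: "norm (c *\<^sub>C x) = cmod c * norm (x :: ell2)"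
proof -
  have "norm (c *\<^sub>C x) = sqrt (\<Sum>i. (cmod c)\<^sup>2 * (cmod (ell2_nth x i))\<^sup>2)"
    unfolding norm_ell2_def by (simp add: ell2_cscale.rep_eq norm_mult power_mult_distrib)
  also have "\<dots> = sqrt ((cmod c)\<^sup>2 * (\<Sum>i. (cmod (ell2_nth x i))\<^sup>2))"
    by (simp only: suminf_mult[OF summable_cmod_square])
  also have "\<dots> = cmod c * norm x"
    unfolding norm_ell2_def by (simp add: real_sqrt_mult)
  finally show ?thesis .
qed

lemma cscale_diff: "c *\<^sub>C (x - y) = c *\<^sub>C x - c *\<^sub>C y"
  unfolding ell2_fps_inject[symmetric] ell2_fps_cscale ell2_fps_diff by (simp only: right_diff_distrib)

lemma cscale_diff_left: "(c - d) *\<^sub>C x = c *\<^sub>C x - d *\<^sub>C x"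
  unfolding ell2_fps_inject[symmetric] ell2_fps_cscale ell2_fps_diff fps_const_sub[symmetric]
  by (simp only: left_diff_distrib)

lemma cscale_add: "c *\<^sub>C (x + y) = c *\<^sub>C x + c *\<^sub>C y"
  unfolding ell2_fps_inject[symmetric] ell2_fps_cscale ell2_fps_add by (simp only: distrib_left)

lemma cscale_scaleR: "c *\<^sub>C (r *\<^sub>R x) = r *\<^sub>R (c *\<^sub>C x)"
  unfolding ell2_fps_inject[symmetric] ell2_fps_cscale scaleR_ell2_def by (simp only: mult.left_commute)

lemma partial_norm_tendsto:
  assumes "\<And>i. (\<lambda>k. F k $ i) \<longlonglongrightarrow> G $ i"
  shows "(\<lambda>k. partial_norm N (F k)) \<longlonglongrightarrow> partial_norm N G"
  unfolding partial_norm_def L2_set_def by (intro tendsto_intros assms)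

text \<open>
  Completeness is needed to solve perturbed equations by a fixed point, and thereby to see that
  the resolvent set is open.
\<close>
instance ell2 :: banach
proof
  fix X :: "nat \<Rightarrow> ell2"
  assume X: "Cauchy X"
  have coord: "cmod (ell2_nth x i) \<le> norm x" for x i
  proof -
    have "cmod (ell2_fps x $ i) \<le> partial_norm (Suc i) (ell2_fps x)"
      using member_le_L2_set[of "{..<Suc i}" i "\<lambda>i. cmod (ell2_fps x $ i)"]
      by (simp add: partial_norm_def)
    then show ?thesis using partial_norm_le_norm[of "Suc i" x] by simp
  qed
  have "\<exists>l. (\<lambda>k. ell2_nth (X k) i) \<longlonglongrightarrow> l" for i
  proof -
    have "Cauchy (\<lambda>k. ell2_nth (X k) i)"
    proof (rule CauchyI)
      fix e :: real assume "e > 0"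
      then obtain M where "\<forall>m\<ge>M. \<forall>n\<ge>M. norm (X m - X n) < e" using CauchyD[OF X] by blast
      moreover have "norm (ell2_nth (X m) i - ell2_nth (X n) i) \<le> norm (X m - X n)" for m n
        using coord[of "X m - X n" i] by (simp add: ell2_fps_diff flip: ell2_fps_nth)
      ultimately show "\<exists>M. \<forall>m\<ge>M. \<forall>n\<ge>M. norm (ell2_nth (X m) i - ell2_nth (X n) i) < e"
        by (blast intro: le_less_trans)
    qed
    then show ?thesis by (simp add: Cauchy_convergent_iff convergent_def)
  qed
  then obtain l where l: "\<And>i. (\<lambda>k. ell2_nth (X k) i) \<longlonglongrightarrow> l i" by metis
  define F where "F = Abs_fps l"
  have close: "\<exists>M. \<forall>n\<ge>M. \<forall>N. partial_norm N (F - ell2_fps (X n)) \<le> e" if e: "e > 0" for e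
  proof -
    obtain M where M: "\<forall>m\<ge>M. \<forall>n\<ge>M. norm (X m - X n) < e" using CauchyD[OF X e] by blast
    have "partial_norm N (F - ell2_fps (X n)) \<le> e" if n: "n \<ge> M" for n N
    proof (rule LIMSEQ_le_const2)
      show "(\<lambda>k. partial_norm N (ell2_fps (X k - X n))) \<longlonglongrightarrow> partial_norm N (F - ell2_fps (X n))"
        by (rule partial_norm_tendsto) (auto simp: ell2_fps_diff F_def intro!: tendsto_intros l)
      have "partial_norm N (ell2_fps (X k - X n)) \<le> e" if "k \<ge> M" for k
        using M that n partial_norm_le_norm[of N "X k - X n"] by fastforce
      then show "\<exists>K. \<forall>k\<ge>K. partial_norm N (ell2_fps (X k - X n)) \<le> e" by blast
    qed
    then show ?thesis by blast
  qed
  obtain M where "\<And>N. partial_norm N (F - ell2_fps (X M)) \<le> 1" using close[of 1] by auto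
  then obtain y where y: "ell2_fps y = F - ell2_fps (X M)" by (rule ell2_of_fps)
  define x where "x = X M + y"
  have x: "ell2_fps x = F" by (simp add: x_def ell2_fps_add y)
  have "X \<longlonglongrightarrow> x"
  proof (rule LIMSEQ_I)
    fix e :: real assume "e > 0"
    then obtain M where M: "\<forall>n\<ge>M. \<forall>N. partial_norm N (F - ell2_fps (X n)) \<le> e / 2"
      using close[of "e / 2"] by auto
    have "norm (X n - x) < e" if "n \<ge> M" for n
    proof -
      have "norm (x - X n) \<le> e / 2"
        by (rule norm_le_partial_norm) (use M that in \<open>simp add: ell2_fps_diff x\<close>)
      then show ?thesis using \<open>e > 0\<close> by (simp add: norm_minus_commute)
    qed
    then show "\<exists>M. \<forall>n\<ge>M. norm (X n - x) < e" by blast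
  qed
  then show "convergent X" by (auto simp: convergent_def)
qed

section \<open>The resolvent set\<close>

lemma norm_le_resolvent:
  assumes "w \<in> resolvent_set T"
  shows "norm x \<le> onorm (resolvent_op T w) * norm (shifted_op T w x)"
proof -
  have b: "bij (shifted_op T w)" and R: "bounded_linear (resolvent_op T w)"
    using assms by (auto simp: resolvent_set_def)
  have "resolvent_op T w (shifted_op T w x) = x"
    using b by (simp add: resolvent_op_def bij_is_inj)
  then show ?thesis using onorm[OF R, of "shifted_op T w x"] by simp
qed

text \<open>
  With \<open>R = (T - w)\<inverse>\<close> and \<open>c = w' - w\<close>, the equation \<open>(T - w') x = z\<close> is the fixed point equation
  \<open>x = R (z + c x)\<close>, whose right-hand side is a contraction in \<open>x\<close> as soon as \<open>|c| \<parallel>R\<parallel> < 1\<close>. Openness matters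
  because it makes the spectrum closed, so that points of the resolvent set have positive distance
  from it.
\<close>
lemma open_resolvent_set: "open (resolvent_set T)"
proof (rule openI)
  fix w assume "w \<in> resolvent_set T"
  then have bij: "bij (shifted_op T w)" and R: "bounded_linear (resolvent_op T w)"
    by (auto simp: resolvent_set_def)
  let ?R = "resolvent_op T w"
  interpret R: bounded_linear ?R by (rule R)
  define K where "K = onorm ?R"
  have K: "0 \<le> K" unfolding K_def by (rule onorm_pos_le[OF R])
  have R_le: "norm (?R x) \<le> K * norm x" for x unfolding K_def by (rule onorm[OF R])
  have "w' \<in> resolvent_set T" if "w' \<in> ball w (1 / (K + 1))" for w'
  proof -
    define c where "c = w' - w"
    define q where "q = K * cmod c"
    have "cmod c * (K + 1) < 1"
      using that K by (simp add: c_def dist_norm norm_minus_commute field_simps)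
    then have q: "0 \<le> q" "q < 1"
      using K mult_nonneg_nonneg[OF K norm_ge_zero[of c]] unfolding q_def
      by (simp, smt (verit) mult.commute norm_ge_zero ring_class.ring_distribs(1) mult_cancel_left1)
    have solve: "shifted_op T w' x = z \<longleftrightarrow> ?R (z + c *\<^sub>C x) = x" for x z
    proof -
      have "shifted_op T w' x = shifted_op T w x - c *\<^sub>C x"
        unfolding shifted_op_def c_def cscale_diff_left by simp
      then have "shifted_op T w' x = z \<longleftrightarrow> shifted_op T w x = z + c *\<^sub>C x"
        by (auto simp: algebra_simps)
      also have "\<dots> \<longleftrightarrow> ?R (z + c *\<^sub>C x) = x"
        unfolding resolvent_op_def using bij by (metis bij_inv_eq_iff)
      finally show ?thesis .
    qed
    have unique: "\<exists>!x. ?R (z + c *\<^sub>C x) = x" for z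
    proof (rule banach_fix_type[OF q], intro allI)
      fix x y
      have "?R (z + c *\<^sub>C x) - ?R (z + c *\<^sub>C y) = ?R (c *\<^sub>C (x - y))"
        by (simp add: cscale_diff flip: R.diff)
      also have "norm \<dots> \<le> q * norm (x - y)"
        using R_le[of "c *\<^sub>C (x - y)"] by (simp add: norm_cscale q_def mult_ac)
      finally show "dist (?R (z + c *\<^sub>C x)) (?R (z + c *\<^sub>C y)) \<le> q * dist x y"
        by (simp add: dist_norm)
    qed
    have bij': "bij (shifted_op T w')"
      unfolding bij_iff solve using unique by blast
    let ?R' = "resolvent_op T w'"
    have R'_eq: "?R (z + c *\<^sub>C ?R' z) = ?R' z" for z
      unfolding solve[symmetric] resolvent_op_def[of T w'] using bij'
      by (simp add: bij_is_surj surj_f_inv_f)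
    have R'_unique: "?R' z = x" if "?R (z + c *\<^sub>C x) = x" for x z
      using unique R'_eq that by blast
    have "bounded_linear ?R'"
    proof (rule bounded_linear_intro)
      show "?R' (y + z) = ?R' y + ?R' z" for y z
      proof (rule R'_unique)
        have "?R (y + z + c *\<^sub>C (?R' y + ?R' z)) = ?R (y + c *\<^sub>C ?R' y) + ?R (z + c *\<^sub>C ?R' z)"
          by (simp add: cscale_add algebra_simps flip: R.add)
        then show "?R (y + z + c *\<^sub>C (?R' y + ?R' z)) = ?R' y + ?R' z" by (simp add: R'_eq)
      qed
      show "?R' (r *\<^sub>R z) = r *\<^sub>R ?R' z" for r z
      proof (rule R'_unique)
        have "?R (r *\<^sub>R z + c *\<^sub>C (r *\<^sub>R ?R' z)) = r *\<^sub>R ?R (z + c *\<^sub>C ?R' z)"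
          by (simp add: cscale_scaleR scaleR_add_right flip: R.scaleR)
        then show "?R (r *\<^sub>R z + c *\<^sub>C (r *\<^sub>R ?R' z)) = r *\<^sub>R ?R' z" by (simp add: R'_eq)
      qed
      show "norm (?R' z) \<le> norm z * (K / (1 - q))" for z
      proof -
        have "norm (?R' z) \<le> K * norm (z + c *\<^sub>C ?R' z)"
          using R_le[of "z + c *\<^sub>C ?R' z"] by (simp add: R'_eq)
        also have "\<dots> \<le> K * (norm z + cmod c * norm (?R' z))"
          using norm_triangle_ineq[of z "c *\<^sub>C ?R' z"] K by (simp add: norm_cscale mult_left_mono)
        finally have "norm (?R' z) * (1 - q) \<le> norm z * K"
          by (simp add: q_def algebra_simps)
        then show ?thesis using q by (simp add: field_simps)
      qed
    qed
    with bij' show ?thesis by (simp add: resolvent_set_def)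
  qed
  moreover have "0 < 1 / (K + 1)" using K by simp
  ultimately show "\<exists>e>0. ball w e \<subseteq> resolvent_set T" by blast
qed

section \<open>Toeplitz operators with a single superdiagonal\<close>

text \<open>
  A matrix \<open>(A\<^sub>i\<^sub>-\<^sub>j\<^sub>+\<^sub>1)\<close> with a single diagonal above the main one: the product with the
  generating series of \<open>A\<close>, shifted down by one index.
\<close>
locale hessenberg_toeplitz =
  fixes A :: "complex fps" and T :: "ell2 \<Rightarrow> ell2"
  assumes weighted_A: "weighted A"
    and action_nth: "ell2_nth (T x) i = (A * ell2_fps x) $ Suc i"
begin

text \<open>If \<open>A(z) = z b(z)\<close>, this is \<open>z (b(z) - w)\<close>.\<close>
definition shifted_symbol :: "complex \<Rightarrow> complex fps"
  where "shifted_symbol w = A - fps_const w * fps_X"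

lemma weighted_shifted_symbol: "weighted (shifted_symbol w)"
  unfolding weighted_def
proof (rule summable_comparison_test'[where N = 0])
  have "summable (\<lambda>n. if n = 1 then cmod w else 0)"
    by (rule summable_finite[of "{1}"]) auto
  with weighted_A show "summable (\<lambda>n. real n * cmod (A $ n) + (if n = 1 then cmod w else 0))"
    unfolding weighted_def by (rule summable_add)
  show "norm (real n * cmod (shifted_symbol w $ n)) \<le> real n * cmod (A $ n) + (if n = 1 then cmod w else 0)" for n
    by (auto simp: shifted_symbol_def norm_triangle_ineq4)
qed

lemma wiener_shifted_symbol: "wiener (shifted_symbol w)"
  by (rule weighted_imp_wiener[OF weighted_shifted_symbol])

lemma eval_shifted_symbol:
  assumes "cmod z \<le> 1"
  shows "eval_fps (shifted_symbol w) z = eval_fps A z - w * z"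
proof -
  have p: "fps_of_poly [:0, w:] = fps_const w * fps_X"
    by (simp add: fps_of_poly_pCons)
  have "wiener (fps_const w * fps_X)" "eval_fps (fps_const w * fps_X) z = w * z"
    unfolding p[symmetric] by simp_all
  then show ?thesis
    unfolding shifted_symbol_def by (simp add: wiener_eval_diff weighted_imp_wiener weighted_A assms)
qed

lemma shifted_op_nth: "ell2_nth (shifted_op T w x) i = (shifted_symbol w * ell2_fps x) $ Suc i"
proof -
  have "ell2_nth (shifted_op T w x) i = ell2_nth (T x) i - w * ell2_nth x i"
    unfolding shifted_op_def ell2_fps_nth[symmetric] ell2_fps_diff ell2_fps_cscale by simp
  then show ?thesis by (simp add: action_nth shifted_symbol_def left_diff_distrib mult.assoc)
qed

text \<open>
  Test vectors: with \<open>P = X / z\<close> the sum \<open>H = \<Sum>\<^sub>i\<^sub><\<^sub>N P\<^sup>i\<close> has norm \<open>\<surd>N\<close>, but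
  \<open>(X - z) H = z (P\<^sup>N - 1)\<close> has at most two nonzero coefficients. As \<open>X - z\<close> divides the
  shifted symbol, the operator maps \<open>X H\<close> to a vector whose norm is bounded independently of \<open>N\<close>. The extra factor \<open>X\<close>
  makes up for the coefficient that the operator drops.
\<close>
lemma circle_root_in_spectrum:
  assumes z: "cmod z = 1" and root: "eval_fps (shifted_symbol w) z = 0"
  shows "w \<in> spectrum T"
proof (rule ccontr)
  assume "w \<notin> spectrum T"
  then have w: "w \<in> resolvent_set T" by (simp add: spectrum_def)
  define K where "K = onorm (resolvent_op T w)"
  have K: "0 \<le> K"
    using w unfolding K_def by (intro onorm_pos_le) (simp add: resolvent_set_def)
  define Q where "Q = root_quotient (shifted_symbol w) z"
  have Q: "wiener Q" unfolding Q_def by (rule wiener_root_quotient[OF weighted_shifted_symbol]) (simp add: z)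
  have GQ: "shifted_symbol w = (fps_X - fps_const z) * Q"
    unfolding Q_def by (rule root_quotient_mult[OF wiener_shifted_symbol _ root]) (simp add: z)
  define P where "P = fps_const (1 / z) * fps_X"
  have z0: "z \<noteq> 0" using z by auto
  have P_pow: "P ^ n = fps_const ((1 / z) ^ n) * fps_X ^ n" for n
    by (simp add: P_def power_mult_distrib flip: fps_const_power)
  have X_minus: "fps_X - fps_const z = fps_const z * (P - 1)"
    using z0 by (simp add: P_def right_diff_distrib fps_const_mult flip: mult.assoc)
  have sqrt_le: "sqrt (real N) \<le> K * (wiener_norm Q * 2)" for N
  proof -
    define H where "H = (\<Sum>i<N. P ^ i)"
    have H_nth: "H $ i = (if i < N then (1 / z) ^ i else 0)" for i
      by (simp add: H_def P_pow fps_sum_nth fps_X_power_nth if_distrib if_distribR sum.delta cong: if_cong)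
    have H_norm: "partial_norm M H \<le> sqrt (real N)" for M
    proof (rule real_le_rsqrt)
      have "(partial_norm M H)\<^sup>2 \<le> (\<Sum>i<M. if i < N then 1 else 0)"
        unfolding partial_norm_power2 by (intro sum_mono) (simp add: H_nth norm_power norm_divide z)
      also have "\<dots> = (\<Sum>i\<in>{..<M} \<inter> {..<N}. 1)"
        by (subst sum.inter_restrict) auto
      also have "\<dots> \<le> real N"
        using card_mono[of "{..<N}" "{..<M} \<inter> {..<N}"] by simp
      finally show "(partial_norm M H)\<^sup>2 \<le> real N" .
    qed
    have H_norm_N: "partial_norm N H = sqrt (real N)"
    proof -
      have "(partial_norm N H)\<^sup>2 = real N"
        unfolding partial_norm_power2 by (simp add: H_nth norm_power norm_divide z)
      then show ?thesis by (metis partial_norm_nonneg real_sqrt_unique)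
    qed
    have "partial_norm M (fps_X ^ 1 * H) \<le> sqrt (real N)" for M
      using partial_norm_X_power_mult_le[of M 1 H] H_norm[of M] by linarith
    then obtain y where y: "ell2_fps y = fps_X ^ 1 * H" by (rule ell2_of_fps)
    have "sqrt (real N) = partial_norm (Suc N) (ell2_fps y)"
      by (simp add: y partial_norm_X_mult H_norm_N)
    also have "\<dots> \<le> norm y" by (rule partial_norm_le_norm)
    also have "\<dots> \<le> K * norm (shifted_op T w y)"
      unfolding K_def by (rule norm_le_resolvent[OF w])
    also have "\<dots> \<le> K * (wiener_norm Q * 2)"
    proof (intro mult_left_mono K norm_le_partial_norm)
      fix M
      have "ell2_fps (shifted_op T w y) = shifted_symbol w * H"
      proof (rule fps_ext)
        fix i
        have "ell2_fps (shifted_op T w y) $ i = (fps_X * (shifted_symbol w * H)) $ Suc i"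
          by (simp only: ell2_fps_nth shifted_op_nth y power_one_right mult.left_commute)
        then show "ell2_fps (shifted_op T w y) $ i = (shifted_symbol w * H) $ i" by simp
      qed
      also have "shifted_symbol w * H = Q * (fps_const z * ((P - 1) * H))"
        by (simp only: GQ X_minus mult_ac)
      also have "(P - 1) * H = P ^ N - 1"
        by (simp only: H_def power_diff_1_eq)
      finally have "partial_norm M (ell2_fps (shifted_op T w y))
          \<le> wiener_norm Q * partial_norm M (P ^ N - 1)"
        using partial_norm_mult_le[OF Q, of M "fps_const z * (P ^ N - 1)"]
        by (simp add: partial_norm_const_mult z)
      also have "partial_norm M (P ^ N) \<le> 1"
        using partial_norm_X_power_mult_le[of M N 1] partial_norm_1_le[of M]
        by (simp add: P_pow partial_norm_const_mult norm_power norm_divide z)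
      then have "partial_norm M (P ^ N - 1) \<le> 2"
        using partial_norm_diff[of M "P ^ N" 1] partial_norm_1_le[of M] by simp
      then have "wiener_norm Q * partial_norm M (P ^ N - 1) \<le> wiener_norm Q * 2"
        by (rule mult_left_mono[OF _ wiener_norm_nonneg[OF Q]])
      finally show "partial_norm M (ell2_fps (shifted_op T w y)) \<le> wiener_norm Q * 2" .
    qed
    finally show ?thesis .
  qed
  let ?B = "K * (wiener_norm Q * 2)"
  obtain N where N: "real N > ?B\<^sup>2" using reals_Archimedean2 by blast
  have "?B < sqrt (real N)" using N by (rule real_less_rsqrt)
  with sqrt_le[of N] show False by simp
qed

text \<open>
  Suppose that the shifted symbol \<open>G\<close> has no root in the open disc. By \<open>circle_root_in_spectrum\<close> it has none in the
  closed disc, so \<open>|G| \<ge> m > 0\<close> there. The reciprocal series \<open>\<phi>\<close> has radius of convergence at least \<open>1\<close>;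
  to see that it is square-summable, apply \<open>partial_norm_mult_ge\<close> to the dilations \<open>G(r z)\<close> and
  \<open>\<phi>(r z)\<close>, whose product is \<open>1\<close>, and let \<open>r\<close> tend to \<open>1\<close>. Finally \<open>G \<phi> = 1\<close> has no coefficients beyond the constant
  one, so \<open>\<phi>\<close> is a nonzero element of the kernel.
\<close>
lemma resolvent_imp_disc_root:
  assumes w: "w \<in> resolvent_set T"
  obtains a where "cmod a < 1" "eval_fps (shifted_symbol w) a = 0"
proof (rule ccontr)
  note goal = that
  assume no: "\<not> thesis"
  have nz: "eval_fps (shifted_symbol w) z \<noteq> 0" if "cmod z \<le> 1" for z
  proof (cases "cmod z = 1")
    case True
    then show ?thesis using circle_root_in_spectrum[of z w] w by (auto simp: spectrum_def)
  next
    case False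
    then show ?thesis using that no goal by force
  qed
  obtain z0 where z0: "z0 \<in> cball 0 1"
    and min: "\<And>z. z \<in> cball 0 1
      \<Longrightarrow> cmod (eval_fps (shifted_symbol w) z0) \<le> cmod (eval_fps (shifted_symbol w) z)"
  proof -
    have "\<exists>x\<in>cball 0 1. \<forall>y\<in>cball 0 1.
        cmod (eval_fps (shifted_symbol w) x) \<le> cmod (eval_fps (shifted_symbol w) y)"
      by (rule continuous_attains_inf)
         (auto intro: continuous_on_norm wiener_continuous_on[OF wiener_shifted_symbol])
    then show ?thesis using that by blast
  qed
  define m where "m = cmod (eval_fps (shifted_symbol w) z0)"
  have m: "m > 0" using nz[of z0] z0 by (simp add: m_def)
  define \<phi> where "\<phi> = inverse (shifted_symbol w)"
  have G0: "shifted_symbol w $ 0 \<noteq> 0" using nz[of 0] by (simp add: eval_fps_at_0)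
  have G\<phi>: "shifted_symbol w * \<phi> = 1" unfolding \<phi>_def by (simp add: inverse_mult_eq_1' G0)
  have "1 \<le> fps_conv_radius (shifted_symbol w)"
    using conv_radius_geI[of "fps_nth (shifted_symbol w)" 1]
      summable_norm_cancel[OF wiener_shifted_symbol[unfolded wiener_def]]
    by (simp add: fps_conv_radius_def one_ereal_def)
  moreover have "min 1 (fps_conv_radius (shifted_symbol w)) \<le> fps_conv_radius \<phi>"
    unfolding \<phi>_def by (rule fps_conv_radius_inverse, rule nz) (simp add: one_ereal_def)
  ultimately have radius: "1 \<le> fps_conv_radius \<phi>" by simp
  \<comment> \<open>Dilation by \<open>r < 1\<close> moves the circle into the region where \<open>\<phi>\<close> converges absolutely.\<close>
  have bound: "partial_norm N (Abs_fps (\<lambda>n. \<phi> $ n * of_real r ^ n)) \<le> 1 / m" if r: "0 \<le> r" "r < 1" for r N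
  proof -
    let ?G = "Abs_fps (\<lambda>n. shifted_symbol w $ n * of_real r ^ n)" and ?\<phi> = "Abs_fps (\<lambda>n. \<phi> $ n * of_real r ^ n)"
    have "ereal (norm (complex_of_real r)) < fps_conv_radius \<phi>"
      using r radius by (intro less_le_trans[OF _ radius]) simp
    then have \<phi>: "wiener ?\<phi>"
      unfolding wiener_def fps_nth_Abs_fps by (rule norm_summable_fps)
    have G: "wiener ?G"
      using wiener_summable[OF wiener_shifted_symbol, of "of_real r" w] r by (simp add: wiener_def)
    have G\<phi>_r: "?G * ?\<phi> = 1"
    proof (rule fps_ext)
      fix n
      have "(?G * ?\<phi>) $ n = (\<Sum>i=0..n. shifted_symbol w $ i * \<phi> $ (n - i) * of_real r ^ n)"
      proof -
        have "(shifted_symbol w $ i * of_real r ^ i) * (\<phi> $ (n - i) * of_real r ^ (n - i))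
            = shifted_symbol w $ i * \<phi> $ (n - i) * of_real r ^ n" if "i \<le> n" for i
        proof -
          have "(shifted_symbol w $ i * of_real r ^ i) * (\<phi> $ (n - i) * of_real r ^ (n - i))
              = shifted_symbol w $ i * \<phi> $ (n - i) * (of_real r ^ i * of_real r ^ (n - i))"
            by (simp only: mult_ac)
          then show ?thesis using that by (simp flip: power_add)
        qed
        then show ?thesis
          unfolding fps_mult_nth fps_nth_Abs_fps by (intro sum.cong refl) simp
      qed
      also have "\<dots> = (shifted_symbol w * \<phi>) $ n * of_real r ^ n"
        unfolding fps_mult_nth by (simp add: sum_distrib_right)
      also have "\<dots> = 1 $ n" by (simp add: G\<phi>)
      finally show "(?G * ?\<phi>) $ n = 1 $ n" .
    qed
    have "m * partial_norm N ?\<phi> \<le> 1"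
    proof (rule partial_norm_mult_ge[OF G])
      show "m \<le> cmod (eval_fps ?G z)" if z: "cmod z = 1" for z
      proof -
        have "eval_fps ?G z = eval_fps (shifted_symbol w) (of_real r * z)"
          by (simp add: eval_fps_def power_mult_distrib mult.assoc)
        then show ?thesis using min[of "of_real r * z"] r z by (simp add: m_def norm_mult)
      qed
      show "partial_norm M ?\<phi> \<le> wiener_norm ?\<phi>" for M by (rule partial_norm_le_wiener_norm[OF \<phi>])
      show "partial_norm M (?G * ?\<phi>) \<le> 1" for M unfolding G\<phi>_r by (rule partial_norm_1_le)
    qed (use m in simp)
    then show ?thesis using m by (simp add: field_simps)
  qed
  have "partial_norm N \<phi> \<le> 1 / m" for N
  proof (rule LIMSEQ_le_const2)
    let ?r = "\<lambda>k. 1 - inverse (real (Suc k))"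
    have r_lim: "?r \<longlonglongrightarrow> 1 - 0" by (intro tendsto_intros LIMSEQ_inverse_real_of_nat)
    show "(\<lambda>k. partial_norm N (Abs_fps (\<lambda>n. \<phi> $ n * of_real (?r k) ^ n))) \<longlonglongrightarrow> partial_norm N \<phi>"
    proof (rule partial_norm_tendsto, unfold fps_nth_Abs_fps)
      fix n
      have "(\<lambda>k. \<phi> $ n * of_real (?r k) ^ n) \<longlonglongrightarrow> \<phi> $ n * of_real (1 - 0) ^ n"
        by (intro tendsto_mult tendsto_power tendsto_of_real tendsto_const r_lim)
      then show "(\<lambda>k. \<phi> $ n * of_real (?r k) ^ n) \<longlonglongrightarrow> \<phi> $ n" by simp
    qed
    have "partial_norm N (Abs_fps (\<lambda>n. \<phi> $ n * of_real (?r k) ^ n)) \<le> 1 / m" for k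
      by (rule bound) (auto simp: field_simps)
    then show "\<exists>K. \<forall>k\<ge>K. partial_norm N (Abs_fps (\<lambda>n. \<phi> $ n * of_real (?r k) ^ n)) \<le> 1 / m" by blast
  qed
  then obtain x where x: "ell2_fps x = \<phi>" by (rule ell2_of_fps)
  have "shifted_op T w x = shifted_op T w 0"
    unfolding ell2_fps_inject[symmetric]
    by (rule fps_ext) (simp add: shifted_op_nth x G\<phi> ell2_fps_0)
  moreover have "inj (shifted_op T w)" using w by (simp add: resolvent_set_def bij_is_inj)
  ultimately have "x = 0" by (simp add: inj_eq)
  then have "\<phi> = 0" using x by (simp add: ell2_fps_0)
  then show False using G\<phi> by simp
qed

text \<open>
  With \<open>G = (X - a) Q\<close> and \<open>u = Q x\<close>, the operator acts on \<open>u\<close> as \<open>1 - a S\<close> for the backward shift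
  \<open>S\<close>, which is a contraction; this gives the factor \<open>1 - |a|\<close>. Passing from \<open>u\<close> back to \<open>x\<close> costs a
  lower bound of \<open>|Q|\<close> on the circle, where \<open>|z - a| \<le> 2\<close>.
\<close>
lemma a_priori_estimate:
  assumes a: "cmod a < 1" and root: "eval_fps (shifted_symbol w) a = 0"
    and d: "0 < d" "\<And>z. cmod z = 1 \<Longrightarrow> d \<le> cmod (eval_fps (shifted_symbol w) z)"
  shows "norm x \<le> 2 / (d * (1 - cmod a)) * norm (shifted_op T w x)"
proof -
  let ?h = "shifted_op T w x"
  have a1: "cmod a \<le> 1" using a by simp
  define Q where "Q = root_quotient (shifted_symbol w) a"
  have Q: "wiener Q" unfolding Q_def by (rule wiener_root_quotient[OF weighted_shifted_symbol a1])
  have GQ: "shifted_symbol w = (fps_X - fps_const a) * Q"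
    unfolding Q_def by (rule root_quotient_mult[OF wiener_shifted_symbol a1 root])
  have "partial_norm N (Q * ell2_fps x) \<le> wiener_norm Q * norm x" for N
    by (rule order_trans[OF partial_norm_mult_le[OF Q]])
       (intro mult_left_mono partial_norm_le_norm wiener_norm_nonneg Q)
  then obtain u where u: "ell2_fps u = Q * ell2_fps x" by (rule ell2_of_fps)
  have u_eq: "ell2_fps u = ell2_fps ?h + fps_const a * fps_shift 1 (ell2_fps u)"
  proof (rule fps_ext)
    fix i
    have "ell2_nth ?h i = ((fps_X - fps_const a) * ell2_fps u) $ Suc i"
      by (simp only: shifted_op_nth GQ u mult.assoc)
    then show "ell2_fps u $ i = (ell2_fps ?h + fps_const a * fps_shift 1 (ell2_fps u)) $ i"
      by (simp add: left_diff_distrib)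
  qed
  have "norm u \<le> norm ?h + cmod a * norm u"
  proof (rule norm_le_partial_norm)
    fix N
    have "partial_norm N (ell2_fps u)
        \<le> partial_norm N (ell2_fps ?h) + cmod a * partial_norm N (fps_shift 1 (ell2_fps u))"
      using partial_norm_add[of N "ell2_fps ?h" "fps_const a * fps_shift 1 (ell2_fps u)"]
      by (simp only: u_eq[symmetric] partial_norm_const_mult)
    also have "\<dots> \<le> norm ?h + cmod a * norm u"
      by (intro add_mono mult_left_mono partial_norm_le_norm
          order_trans[OF partial_norm_fps_shift_le partial_norm_le_norm]) simp
    finally show "partial_norm N (ell2_fps u) \<le> norm ?h + cmod a * norm u" .
  qed
  then have u_le: "(1 - cmod a) * norm u \<le> norm ?h" by (simp add: algebra_simps)
  have "d / 2 * partial_norm N (ell2_fps x) \<le> norm u" for N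
  proof (rule partial_norm_mult_ge[OF Q])
    show "d / 2 \<le> cmod (eval_fps Q z)" if z: "cmod z = 1" for z
    proof -
      have "d \<le> cmod (z - a) * cmod (eval_fps Q z)"
        using d(2)[OF z] eval_root_quotient[OF weighted_shifted_symbol a1 root, of z] z
        by (simp add: Q_def norm_mult)
      also have "\<dots> \<le> 2 * cmod (eval_fps Q z)"
        using norm_triangle_ineq4[of z a] z a by (intro mult_right_mono) auto
      finally show ?thesis by simp
    qed
    show "partial_norm M (ell2_fps x) \<le> norm x" for M by (rule partial_norm_le_norm)
    show "partial_norm M (Q * ell2_fps x) \<le> norm u" for M
      unfolding u[symmetric] by (rule partial_norm_le_norm)
  qed (use d in simp)
  then have "partial_norm N (ell2_fps x) \<le> 2 / d * norm u" for N
    using d by (simp add: field_simps)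
  then have "norm x \<le> 2 / d * norm u" by (rule norm_le_partial_norm)
  also have "\<dots> \<le> 2 / d * (norm ?h / (1 - cmod a))"
    using u_le a d by (intro mult_left_mono) (simp_all add: field_simps)
  finally show ?thesis by simp
qed

text \<open>
  A root near the circle forces \<open>G\<close> to be small at the nearest point \<open>\<mu> = a / |a|\<close> of the circle.
  Since \<open>G\<close> depends on \<open>w\<close>, its Lipschitz constant is not uniform; the root equation \<open>w = A(a) / a\<close>
  eliminates \<open>w\<close> and leaves a constant that depends only on \<open>A\<close>.
\<close>
lemma disc_root_margin:
  assumes a: "cmod a < 1" and root: "eval_fps (shifted_symbol w) a = 0"
    and d: "0 < d" "\<And>z. cmod z = 1 \<Longrightarrow> d \<le> cmod (eval_fps (shifted_symbol w) z)"
  shows "1 / (1 - cmod a) \<le> (2 + weighted_norm A + 2 * wiener_norm A) * (1 + 1 / d)"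
proof -
  note A = weighted_imp_wiener[OF weighted_A]
  define M where "M = weighted_norm A + 2 * wiener_norm A"
  have M: "0 \<le> M" using weighted_norm_nonneg[OF weighted_A] wiener_norm_nonneg[OF A] by (simp add: M_def)
  have "1 / (1 - cmod a) \<le> 2 + M / d"
  proof (cases "cmod a \<le> 1 / 2")
    case True
    then have "1 / (1 - cmod a) \<le> 2" by (simp add: field_simps)
    moreover have "0 \<le> M / d" using M d by simp
    ultimately show ?thesis by linarith
  next
    case False
    define r where "r = cmod a"
    define \<mu> where "\<mu> = a / of_real r"
    have r: "1 / 2 < r" "r < 1" using False a by (simp_all add: r_def)
    have a_eq: "a = of_real r * \<mu>" using r by (simp add: \<mu>_def)
    have \<mu>: "cmod \<mu> = 1" using r by (simp add: \<mu>_def norm_divide) (simp add: r_def)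
    have dist: "cmod (\<mu> - a) = 1 - r"
    proof -
      have "\<mu> - a = of_real (1 - r) * \<mu>" by (simp add: a_eq algebra_simps)
      then show ?thesis using r \<mu> by (simp only: norm_mult norm_of_real) simp
    qed
    have Aa: "eval_fps A a = w * a" using root eval_shifted_symbol[of a w] a by simp
    have "eval_fps (shifted_symbol w) \<mu> = (eval_fps A \<mu> - eval_fps A a) - of_real (1 / r - 1) * eval_fps A a"
    proof -
      have "w * \<mu> = of_real (1 / r) * eval_fps A a"
        using r by (simp add: Aa \<mu>_def)
      then show ?thesis using \<mu> by (simp add: eval_shifted_symbol algebra_simps)
    qed
    then have "d \<le> cmod (eval_fps A \<mu> - eval_fps A a) + cmod (of_real (1 / r - 1) * eval_fps A a)"
      using d(2)[OF \<mu>] norm_triangle_ineq4 order_trans by metis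
    also have "cmod (eval_fps A \<mu> - eval_fps A a) \<le> weighted_norm A * (1 - r)"
      using weighted_Lipschitz[OF weighted_A, of \<mu> a] \<mu> a by (simp add: dist)
    also have "cmod (of_real (1 / r - 1) * eval_fps A a) \<le> (2 * (1 - r)) * wiener_norm A"
    proof -
      have "1 / r - 1 \<le> 2 * (1 - r)"
      proof -
        have "1 / r - 1 = (1 - r) * (1 / r)" using r by (simp add: field_simps)
        also have "\<dots> \<le> (1 - r) * 2" using r by (intro mult_left_mono) (simp_all add: field_simps)
        finally show ?thesis by simp
      qed
      moreover have "0 \<le> 1 / r - 1" using r by (simp add: field_simps)
      ultimately show ?thesis
        using wiener_norm_eval_le[OF A, of a] a r
        unfolding norm_mult norm_of_real by (intro mult_mono) auto
    qed
    finally have "d \<le> M * (1 - r)" by (simp add: M_def algebra_simps)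
    then have "1 / (1 - r) \<le> M / d" using d r by (simp add: field_simps)
    then show ?thesis by (simp add: r_def)
  qed
  also have "\<dots> \<le> (2 + M) * (1 + 1 / d)" using M d by (simp add: field_simps)
  finally show ?thesis by (simp add: M_def add.assoc)
qed

text \<open>
  The spectrum contains \<open>A(z) / z\<close> for every \<open>z\<close> on the circle. Hence it is nonempty, so its distance from \<open>w\<close> is
  a genuine infimum, and that distance is a lower bound for the shifted symbol on the circle.
\<close>
lemma onorm_resolvent_le:
  "\<exists>C>0. \<forall>w\<in>resolvent_set T. onorm (resolvent_op T w)
    \<le> C / infdist w (spectrum T) * (1 + 1 / infdist w (spectrum T))"
proof -
  define M where "M = 2 + weighted_norm A + 2 * wiener_norm A"
  have M: "M > 0"
    using weighted_norm_nonneg[OF weighted_A] wiener_norm_nonneg[OF weighted_imp_wiener[OF weighted_A]]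
    by (simp add: M_def)
  have circle: "eval_fps A z / z \<in> spectrum T" if "cmod z = 1" for z
    using that by (intro circle_root_in_spectrum[of z]) (auto simp: eval_shifted_symbol)
  show ?thesis
  proof (intro exI conjI ballI)
    show "0 < 2 * M" using M by simp
    fix w assume w: "w \<in> resolvent_set T"
    define d where "d = infdist w (spectrum T)"
    have "closed (spectrum T)" unfolding spectrum_def using open_resolvent_set by (rule closed_Compl)
    moreover have "spectrum T \<noteq> {}" using circle[of 1] by auto
    ultimately have "d \<noteq> 0"
      using w in_closed_iff_infdist_zero[of "spectrum T" w] by (simp add: d_def spectrum_def)
    then have d: "0 < d" using infdist_nonneg[of w "spectrum T"] by (simp add: d_def)
    have d_le: "d \<le> cmod (eval_fps (shifted_symbol w) z)" if z: "cmod z = 1" for z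
    proof -
      have "eval_fps (shifted_symbol w) z = - ((w - eval_fps A z / z) * z)"
        using z by (auto simp: eval_shifted_symbol field_simps)
      then have "cmod (eval_fps (shifted_symbol w) z) = dist w (eval_fps A z / z)"
        by (simp add: norm_mult z dist_norm)
      then show ?thesis using infdist_le[OF circle[OF z], of w] by (simp add: d_def)
    qed
    obtain a where a: "cmod a < 1" "eval_fps (shifted_symbol w) a = 0" by (rule resolvent_imp_disc_root[OF w])
    have bij: "bij (shifted_op T w)" using w by (simp add: resolvent_set_def)
    have "onorm (resolvent_op T w) \<le> 2 / (d * (1 - cmod a))"
    proof (rule onorm_bound)
      fix h
      have "shifted_op T w (resolvent_op T w h) = h"
        unfolding resolvent_op_def using bij by (simp add: bij_is_surj surj_f_inv_f)
      then show "norm (resolvent_op T w h) \<le> 2 / (d * (1 - cmod a)) * norm h"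
        using a_priori_estimate[OF a d d_le, of "resolvent_op T w h"] by simp
    qed (use d a in simp)
    also have "\<dots> = 2 / d * (1 / (1 - cmod a))" by simp
    also have "\<dots> \<le> 2 / d * (M * (1 + 1 / d))"
      using disc_root_margin[OF a d d_le] d unfolding M_def by (intro mult_left_mono) auto
    finally show "onorm (resolvent_op T w)
        \<le> 2 * M / infdist w (spectrum T) * (1 + 1 / infdist w (spectrum T))"
      by (simp add: d_def)
  qed
qed

end

section \<open>The Fourier coefficients of the symbol\<close>

lemma has_integral_cis:
  fixes m :: int
  shows "((\<lambda>\<theta>. cis (of_int m * \<theta>)) has_integral (if m = 0 then 2 * pi else 0)) {0..2 * pi}"
proof (cases "m = 0")
  case True
  then show ?thesis using has_integral_const_real[of "1 :: complex" 0 "2 * pi"] by (simp add: scaleR_conv_of_real)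
next
  case False
  define F where "F = (\<lambda>z. exp (\<i> * of_int m * z) / (\<i> * of_int m))"
  have F: "F (of_real \<theta>) = cis (of_int m * \<theta>) / (\<i> * of_int m)" for \<theta>
    by (simp add: F_def cis_conv_exp mult.assoc)
  have "((\<lambda>\<theta>. cis (of_int m * \<theta>)) has_integral (F (of_real (2 * pi)) - F (of_real 0))) {0..2 * pi}"
  proof (rule fundamental_theorem_of_calculus)
    fix \<theta> :: real
    have "(F has_field_derivative exp (\<i> * of_int m * of_real \<theta>)) (at (of_real \<theta>))"
      unfolding F_def using False by (auto intro!: derivative_eq_intros)
    then have "((\<lambda>x. F (of_real x)) has_vector_derivative exp (\<i> * of_int m * of_real \<theta>))
        (at \<theta> within {0..2 * pi})"
      by (rule has_vector_derivative_real_field)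
    then show "((\<lambda>x. F (of_real x)) has_vector_derivative cis (of_int m * \<theta>)) (at \<theta> within {0..2 * pi})"
      by (simp add: cis_conv_exp mult.assoc)
  qed simp
  moreover have "cis (of_int m * (2 * pi)) = 1"
    using cis_multiple_2pi[of "of_int m"] by (simp add: mult.commute)
  ultimately show ?thesis using False by (simp only: F) simp
qed

text \<open>
  The convergence is uniform in \<open>\<theta>\<close>, so the series may be integrated term by term, and only the term
  with \<open>n - 1 = k\<close> survives.
\<close>
lemma fourier_coeff_powser:
  assumes A: "wiener A"
    and f: "\<And>\<theta>. (\<lambda>n. A $ n * cis ((real n - 1) * \<theta>)) sums f (cis \<theta>)"
  shows "fourier_coeff f k = (if k \<ge> -1 then A $ nat (k + 1) else 0)"
proof -
  let ?c = "\<lambda>n. int n - 1 - k"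
  let ?S = "\<lambda>N \<theta>. \<Sum>n<N. A $ n * cis (of_int (?c n) * \<theta>)"
  let ?g = "\<lambda>\<theta>. f (cis \<theta>) * cis (- (of_int k * \<theta>))"
  have sums: "(\<lambda>n. A $ n * cis (of_int (?c n) * \<theta>)) sums ?g \<theta>" for \<theta>
    using sums_mult2[OF f[of \<theta>], of "cis (- (of_int k * \<theta>))"]
    by (simp add: mult.assoc cis_mult algebra_simps)
  have lim: "uniform_limit {0..2 * pi} ?S (\<lambda>\<theta>. \<Sum>n. A $ n * cis (of_int (?c n) * \<theta>)) sequentially"
    by (rule Weierstrass_m_test[OF _ A[unfolded wiener_def]]) (simp add: norm_mult)
  have "(\<lambda>\<theta>. \<Sum>n. A $ n * cis (of_int (?c n) * \<theta>)) = ?g"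
    using sums by (auto simp: sums_iff)
  with lim have lim: "uniform_limit {0..2 * pi} ?S ?g sequentially" by simp
  have cont: "continuous_on {0..2 * pi} (?S N)" for N
    by (intro continuous_intros)
  obtain I J where I: "\<And>N. (?S N has_integral I N) {0..2 * pi}"
    and J: "(?g has_integral J) {0..2 * pi}" and IJ: "I \<longlonglongrightarrow> J"
    using uniform_limit_integral[OF lim cont trivial_limit_sequentially] by blast
  define v where "v = (if k \<ge> -1 then A $ nat (k + 1) else 0)"
  have I_eq: "I N = (\<Sum>n<N. A $ n * (if ?c n = 0 then 2 * pi else 0))" for N
    by (rule has_integral_unique[OF I])
       (intro has_integral_sum has_integral_mult_right has_integral_cis finite_lessThan)
  have "I N = 2 * pi * v" if N: "N > nat (k + 1)" for N
  proof (cases "k \<ge> -1")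
    case True
    have "I N = (\<Sum>n<N. if n = nat (k + 1) then A $ n * (2 * pi) else 0)"
      unfolding I_eq by (intro sum.cong refl) (use True in auto)
    then show ?thesis using N True by (simp add: v_def mult.commute)
  next
    case False
    then show ?thesis unfolding I_eq v_def by (auto intro!: sum.neutral)
  qed
  then have "I \<longlonglongrightarrow> 2 * pi * v"
    by (intro tendsto_eventually eventually_sequentiallyI[of "Suc (nat (k + 1))"]) simp
  then have "J = 2 * pi * v" using IJ LIMSEQ_unique by blast
  then show ?thesis
    using integral_unique[OF J] unfolding fourier_coeff_def v_def by simp
qed

lemma toeplitz_hessenberg:
  assumes A: "weighted A"
    and coeff: "\<And>k. fourier_coeff f k = (if k \<ge> -1 then A $ nat (k + 1) else 0)"
  shows "hessenberg_toeplitz A (toeplitz f)"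
proof
  show "weighted A" by fact
  fix x i
  have bij: "bij_betw (\<lambda>n. int n - 1) UNIV {-1..}"
    by (rule bij_betwI[of _ _ _ "\<lambda>k. nat (k + 1)"]) auto
  have "(\<lambda>n. cmod (fourier_coeff f (int n - 1))) summable_on UNIV"
    using weighted_imp_wiener[OF A] by (simp add: summable_on_UNIV_nonneg_real_iff coeff wiener_def)
  then have "(\<lambda>k. cmod (fourier_coeff f k)) summable_on {-1..}"
    by (simp only: summable_on_reindex_bij_betw[OF bij, of "\<lambda>k. cmod (fourier_coeff f k)"])
  then have "(\<lambda>k. cmod (fourier_coeff f k)) summable_on UNIV"
    by (subst (asm) summable_on_cong_neutral[where T = UNIV and g = "\<lambda>k. cmod (fourier_coeff f k)"])
       (auto simp: coeff)
  then have "ell2_nth (toeplitz f x) i = (\<Sum>j. fourier_coeff f (int i - int j) * ell2_nth x j)"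
    by (rule ell2_nth_toeplitz)
  also have "\<dots> = (\<Sum>j\<le>Suc i. fourier_coeff f (int i - int j) * ell2_nth x j)"
    by (rule suminf_finite) (auto simp: coeff)
  also have "\<dots> = (\<Sum>j\<le>Suc i. A $ (Suc i - j) * ell2_fps x $ j)"
  proof (intro sum.cong refl)
    fix j assume "j \<in> {..Suc i}"
    then have "nat (int i - int j + 1) = Suc i - j" "int i - int j \<ge> -1" by auto
    then show "fourier_coeff f (int i - int j) * ell2_nth x j = A $ (Suc i - j) * ell2_fps x $ j"
      by (simp only: coeff ell2_fps_nth if_True)
  qed
  also have "\<dots> = (A * ell2_fps x) $ Suc i"
    unfolding mult.commute[of A] fps_mult_nth atLeast0AtMost by (intro sum.cong refl mult.commute)
  finally show "ell2_nth (toeplitz f x) i = (A * ell2_fps x) $ Suc i" .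
qed

theorem theorem3p1:
  fixes b :: "complex \<Rightarrow> complex" and b_coeff :: "int \<Rightarrow> complex"
  assumes symbol: "\<And>t. cmod t = 1 \<Longrightarrow> ((\<lambda>j. b_coeff j * t powi j) has_sum b t) {-1..}"
    and weight: "(\<lambda>j. (of_int j + 1) * cmod (b_coeff j)) summable_on {0..}"
  shows "\<exists>C>0. \<forall>w\<in>resolvent_set (toeplitz b).
           onorm (resolvent_op (toeplitz b) w)
             \<le> C / infdist w (spectrum (toeplitz b)) * (1 + 1 / infdist w (spectrum (toeplitz b)))"
proof -
  define A where "A = Abs_fps (\<lambda>n. b_coeff (int n - 1))"
  have bij0: "bij_betw int UNIV {0..}"
    by (rule bij_betwI[of _ _ _ nat]) auto
  have bij1: "bij_betw (\<lambda>n. int n - 1) UNIV {-1..}"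
    by (rule bij_betwI[of _ _ _ "\<lambda>k. nat (k + 1)"]) auto
  have "(\<lambda>n. (of_int (int n) + 1) * cmod (b_coeff (int n))) summable_on UNIV"
    using weight
    by (simp only: summable_on_reindex_bij_betw[OF bij0, of "\<lambda>j. (of_int j + 1) * cmod (b_coeff j)"])
  then have "summable (\<lambda>n. (of_int (int n) + 1) * cmod (b_coeff (int n)))"
    by (rule summable_on_imp_summable)
  then have "summable (\<lambda>n. real (Suc n) * cmod (A $ Suc n))"
    by (simp add: A_def add.commute)
  then have A: "weighted A"
    unfolding weighted_def by (subst (asm) summable_Suc_iff)
  have "(\<lambda>n. A $ n * cis ((real n - 1) * \<theta>)) sums b (cis \<theta>)" for \<theta>
  proof -
    have "((\<lambda>n. b_coeff (int n - 1) * cis \<theta> powi (int n - 1)) has_sum b (cis \<theta>)) UNIV"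
      using symbol[of "cis \<theta>"]
      by (simp only: has_sum_reindex_bij_betw[OF bij1, of "\<lambda>j. b_coeff j * cis \<theta> powi j"] norm_cis)
    then show ?thesis
      by (auto dest!: has_sum_imp_sums simp: A_def cis_power_int)
  qed
  then interpret hessenberg_toeplitz A "toeplitz b"
    by (intro toeplitz_hessenberg A fourier_coeff_powser weighted_imp_wiener)
  show ?thesis by (rule onorm_resolvent_le)
qed

end
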